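(* There is an infinite collection of virtual links $L(n)$, $n=1,2,3,\ldots$, such that for each $n$ the virtual crossing number of $L(n)$ is $n$ and $L(n)$ can be represented by an embedding in a thickened torus.
   Context: A virtual link diagram is a generic immersion of finitely many circles in the plane in which each double point is either a classical crossing (with over/under information) or a virtual crossing. A virtual link is an equivalence class of such diagrams under virtual isotopy, generated by planar isotopy, the classical Reidemeister moves I, II, III, and detour moves: a segment containing only consecutive virtual crossings may be replaced by any other generic segment with the same endpoints all of whose crossings are virtual. The virtual crossing number of a virtual link is the least number of virtual crossings in any diagram representing it. Virtual links correspond to links embedded in thickened compact oriented surfaces $S_g\times\mathbb{R}$, up to isotopy, homeomorphisms of the surfaces, and addition or removal of empty handles (the link projected to the surface gives the classical crossings; further projection to the plane creates the virtual crossings); being represented in a thickened torus refers to this correspondence. *)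

theory Defs
  imports "HOL-Analysis.Analysis"
begin

subsection \<open>Virtual link diagrams\<close>

text \<open>The disjoint union of \<open>m\<close> circles; the first coordinate numbers the circle.\<close>

definition circles :: "nat \<Rightarrow> (nat \<times> complex) set" where
  "circles m = {..<m} \<times> sphere 0 1"

text \<open>A diagram is a map from circles to the plane together with the crossing information:
  \<open>(x, y) \<in> over D\<close> says that \<open>x\<close> and \<open>y\<close> are the two preimages of a classical crossing and that
  the strand through \<open>x\<close> passes over the strand through \<open>y\<close>.  A double point whose preimages
  are not related by \<open>over\<close> in either order is a virtual crossing.\<close>

record vdiagram =
  circle_count :: nat
  curve :: "nat \<times> complex \<Rightarrow> complex"
  over :: "((nat \<times> complex) \<times> (nat \<times> complex)) set"

abbreviation dom_circles :: "vdiagram \<Rightarrow> (nat \<times> complex) set" where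
  "dom_circles D \<equiv> circles (circle_count D)"

definition double_points :: "vdiagram \<Rightarrow> ((nat \<times> complex) \<times> (nat \<times> complex)) set" where
  "double_points D =
     {(x, y). x \<in> dom_circles D \<and> y \<in> dom_circles D \<and> x \<noteq> y \<and> curve D x = curve D y}"

definition tangent :: "vdiagram \<Rightarrow> nat \<times> complex \<Rightarrow> complex" where
  "tangent D x = vector_derivative (\<lambda>t. curve D (fst x, snd x * cis t)) (at 0)"

definition generic_immersion :: "vdiagram \<Rightarrow> bool" where
  "generic_immersion D \<longleftrightarrow>
     (\<forall>i<circle_count D. (\<lambda>t. curve D (i, cis t)) C1_differentiable_on UNIV) \<and>
     (\<forall>x\<in>dom_circles D. tangent D x \<noteq> 0) \<and>
     finite (double_points D) \<and>
     (\<forall>(x, y)\<in>double_points D. \<not> collinear {0, tangent D x, tangent D y}) \<and>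
     (\<forall>x y z. (x, y) \<in> double_points D \<and> (x, z) \<in> double_points D \<longrightarrow> y = z)"

definition virtual_link_diagram :: "vdiagram \<Rightarrow> bool" where
  "virtual_link_diagram D \<longleftrightarrow>
     generic_immersion D \<and> over D \<subseteq> double_points D \<and> asym (over D)"

definition virtual_crossings :: "vdiagram \<Rightarrow> complex set" where
  "virtual_crossings D =
     {curve D x | x y. (x, y) \<in> double_points D \<and> (x, y) \<notin> over D \<and> (y, x) \<notin> over D}"

subsection \<open>Virtual isotopy\<close>

text \<open>Links are unoriented with unordered components: the reparametrization \<open>f\<close> of the circles
  is an arbitrary homeomorphism, so it may permute circles and reverse them.\<close>

definition planar_isotopic :: "vdiagram \<Rightarrow> vdiagram \<Rightarrow> bool" where
  "planar_isotopic D D' \<longleftrightarrow>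
     (\<exists>h f g.
        homotopic_with_canon (\<lambda>k. \<exists>k'. homeomorphism UNIV UNIV k k') UNIV UNIV id h \<and>
        homeomorphism (dom_circles D) (dom_circles D') f g \<and>
        (\<forall>x\<in>dom_circles D. curve D' (f x) = h (curve D x)) \<and>
        (\<forall>x\<in>dom_circles D. \<forall>y\<in>dom_circles D. (f x, f y) \<in> over D' \<longleftrightarrow> (x, y) \<in> over D))"

definition arc_of_circle :: "nat \<Rightarrow> real \<Rightarrow> real \<Rightarrow> (nat \<times> complex) set" where
  "arc_of_circle i a b = {i} \<times> cis ` {a..b}"

definition is_arc :: "nat \<Rightarrow> (nat \<times> complex) set \<Rightarrow> bool" where
  "is_arc m A \<longleftrightarrow> (\<exists>i<m. \<exists>a b. a < b \<and> b < a + 2 * pi \<and> A = arc_of_circle i a b)"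

definition proper_strand :: "complex \<Rightarrow> real \<Rightarrow> vdiagram \<Rightarrow> (nat \<times> complex) set \<Rightarrow> bool" where
  "proper_strand c r D A \<longleftrightarrow>
     (\<exists>i<circle_count D. \<exists>a b. a < b \<and> b < a + 2 * pi \<and> A = arc_of_circle i a b \<and>
        (\<forall>t. a < t \<and> t < b \<longrightarrow> curve D (i, cis t) \<in> ball c r) \<and>
        curve D (i, cis a) \<in> sphere c r \<and> curve D (i, cis b) \<in> sphere c r)"

text \<open>\<open>D\<close> and \<open>D'\<close> meet the disk \<open>cball c r\<close> exactly in the strands \<open>S\<close>, and coincide outside it.
  Round disks suffice: planar isotopy moves any disk to a round one.\<close>

definition differ_in_disk ::
    "complex \<Rightarrow> real \<Rightarrow> (nat \<times> complex) set set \<Rightarrow> vdiagram \<Rightarrow> vdiagram \<Rightarrow> bool" where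
  "differ_in_disk c r S D D' \<longleftrightarrow>
     r > 0 \<and> circle_count D' = circle_count D \<and>
     (\<forall>A\<in>S. proper_strand c r D A \<and> proper_strand c r D' A) \<and>
     (\<forall>x\<in>dom_circles D - \<Union>S. curve D' x = curve D x \<and> curve D x \<notin> cball c r) \<and>
     (\<forall>x\<in>dom_circles D - \<Union>S. \<forall>y\<in>dom_circles D - \<Union>S. (x, y) \<in> over D' \<longleftrightarrow> (x, y) \<in> over D)"

text \<open>The strands over \<open>A\<close> cross each other precisely at the classical crossings \<open>X\<close>,
  given as (over, under) pairs.\<close>

definition crossings_are ::
    "vdiagram \<Rightarrow> (nat \<times> complex) set \<Rightarrow> ((nat \<times> complex) \<times> (nat \<times> complex)) set \<Rightarrow> bool" where
  "crossings_are D A X \<longleftrightarrow> double_points D \<inter> A \<times> A = X \<union> X\<inverse> \<and> X \<subseteq> over D"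

text \<open>The Reidemeister moves replace one tangle in a disk by another.  Up to an isotopy of the disk
  fixing its boundary, a tangle of the following kinds is determined by its endpoints and the
  crossing pattern, except for the side and order of the crossings.  A strand with one self-crossing
  is a kink; two embedded strands with two crossings bound a bigon; and three embedded strands
  crossing pairwise once form a triangle, on one of two sides.  If the two triangles are
  on the same side, \<open>reidemeister3\<close> relates planar isotopic diagrams.\<close>

definition reidemeister1 :: "vdiagram \<Rightarrow> vdiagram \<Rightarrow> bool" where
  "reidemeister1 D D' \<longleftrightarrow>
     (\<exists>c r A. differ_in_disk c r {A} D D' \<and> crossings_are D A {} \<and>
        (\<exists>x y. crossings_are D' A {(x, y)}))"

definition reidemeister2 :: "vdiagram \<Rightarrow> vdiagram \<Rightarrow> bool" where
  "reidemeister2 D D' \<longleftrightarrow>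
     (\<exists>c r A B. A \<inter> B = {} \<and> differ_in_disk c r {A, B} D D' \<and> crossings_are D (A \<union> B) {} \<and>
        (\<exists>x\<in>A. \<exists>x'\<in>B. \<exists>y\<in>A. \<exists>y'\<in>B. x \<noteq> y \<and> crossings_are D' (A \<union> B) {(x, x'), (y, y')}))"

definition layered_triangle ::
    "vdiagram \<Rightarrow> (nat \<times> complex) set \<Rightarrow> (nat \<times> complex) set \<Rightarrow> (nat \<times> complex) set \<Rightarrow> bool" where
  "layered_triangle D A B C \<longleftrightarrow>
     (\<exists>ab\<in>A. \<exists>ac\<in>A. \<exists>ba\<in>B. \<exists>bc\<in>B. \<exists>ca\<in>C. \<exists>cb\<in>C.
        crossings_are D (A \<union> B \<union> C) {(ab, ba), (ac, ca), (bc, cb)})"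

definition reidemeister3 :: "vdiagram \<Rightarrow> vdiagram \<Rightarrow> bool" where
  "reidemeister3 D D' \<longleftrightarrow>
     (\<exists>c r A B C. A \<inter> B = {} \<and> A \<inter> C = {} \<and> B \<inter> C = {} \<and> differ_in_disk c r {A, B, C} D D' \<and>
        layered_triangle D A B C \<and> layered_triangle D' A B C)"

definition detour_move :: "vdiagram \<Rightarrow> vdiagram \<Rightarrow> bool" where
  "detour_move D D' \<longleftrightarrow>
     circle_count D' = circle_count D \<and> over D' = over D \<and>
     (\<exists>A. is_arc (circle_count D) A \<and>
        (\<forall>(x, y)\<in>over D. x \<notin> A \<and> y \<notin> A) \<and>
        (\<forall>x\<in>dom_circles D - A. curve D' x = curve D x))"

definition elementary_move :: "(vdiagram \<times> vdiagram) set" where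
  "elementary_move =
     {(D, D'). virtual_link_diagram D \<and> virtual_link_diagram D' \<and>
        (planar_isotopic D D' \<or> reidemeister1 D D' \<or> reidemeister2 D D' \<or> reidemeister3 D D' \<or>
         detour_move D D')}"

definition virtual_isotopy :: "(vdiagram \<times> vdiagram) set" where
  "virtual_isotopy = (elementary_move \<union> elementary_move\<inverse>)\<^sup>*"

definition virtual_links :: "vdiagram set set" where
  "virtual_links = {D. virtual_link_diagram D} // virtual_isotopy"

definition virtual_crossing_number :: "vdiagram set \<Rightarrow> nat" where
  "virtual_crossing_number L = (LEAST k. \<exists>D\<in>L. card (virtual_crossings D) = k)"

subsection \<open>Links in the thickened torus\<close>

definition torus :: "(complex \<times> complex) set" where
  "torus = sphere 0 1 \<times> sphere 0 1"

definition torus_cover :: "real \<times> real \<Rightarrow> complex \<times> complex" where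
  "torus_cover w = (cis (fst w), cis (snd w))"

text \<open>A \<open>C\<^sup>1\<close> orientation-preserving immersion of the open subset \<open>N\<close> of the torus into
  the plane, expressed on the universal cover; the last condition says that the Jacobian determinant
  is positive.\<close>

definition oriented_immersion ::
    "(complex \<times> complex) set \<Rightarrow> (complex \<times> complex \<Rightarrow> complex) \<Rightarrow> bool" where
  "oriented_immersion N \<phi> \<longleftrightarrow>
     openin (top_of_set torus) N \<and>
     (\<exists>J. (\<forall>w. torus_cover w \<in> N \<longrightarrow> ((\<lambda>v. \<phi> (torus_cover v)) has_derivative J w) (at w)) \<and>
          (\<forall>v. continuous_on {w. torus_cover w \<in> N} (\<lambda>w. J w v)) \<and>
          (\<forall>w. torus_cover w \<in> N \<longrightarrow> Im (cnj (J w (1, 0)) * J w (0, 1)) > 0))"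

text \<open>The correspondence with virtual links: the embedded link \<open>e\<close> is projected to the torus, whose
  double points become the classical crossings (larger height is over), and a neighbourhood of this
  projection is mapped to the plane by an immersion preserving orientation, whose further
  double points become the virtual crossings.\<close>

definition represented_by :: "(nat \<times> complex \<Rightarrow> (complex \<times> complex) \<times> real) \<Rightarrow> vdiagram \<Rightarrow> bool" where
  "represented_by e D \<longleftrightarrow>
     embedding_map (top_of_set (dom_circles D)) (top_of_set (torus \<times> UNIV)) e \<and>
     (\<exists>N \<phi>. oriented_immersion N \<phi> \<and>
        (\<forall>x\<in>dom_circles D. fst (e x) \<in> N \<and> curve D x = \<phi> (fst (e x)))) \<and>
     over D = {(x, y). x \<in> dom_circles D \<and> y \<in> dom_circles D \<and>
                       fst (e x) = fst (e y) \<and> snd (e x) > snd (e y)}"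

definition representable_in_thickened_torus :: "vdiagram set \<Rightarrow> bool" where
  "representable_in_thickened_torus L \<longleftrightarrow>
     (\<exists>D\<in>L. virtual_link_diagram D \<and> (\<exists>e. represented_by e D))"

end

theory Submission
  imports Defs "HOL-Complex_Analysis.Winding_Numbers"
begin

text \<open>The link \<open>L(n)\<close> consists of one longitude \<open>{\<psi> = 0}\<close> of the torus and \<open>n\<close> parallel meridians
  \<open>{\<theta> = \<theta>\<^sub>k}\<close>, lifted so that the longitude passes above.  In the plane the meridians
  become concentric circles, and the longitude becomes a round circle that crosses each of
  them twice: once at the image of the crossing on the torus, and once more, virtually.  So
  \<open>n\<close> virtual crossings suffice.

  That \<open>n\<close> are necessary is a parity argument.  Call two components of a diagram oddly linked
  if they have an odd number of classical crossings with each other.  Planar isotopies permute the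
  components, the first Reidemeister move creates a crossing of a component with itself,
  the second one creates two crossings between the same two components, the third one keeps, and
  detour moves do not touch, the classical crossings; so the number of oddly linked pairs is an
  invariant of virtual links (\<open>card_odd_pairs_invariant\<close>).  On the other hand two distinct
  components, being closed plane curves in general position, meet in an even number of double points
  (\<open>even_crossings_of_closed_curves\<close>), so that every oddly linked pair has a virtual crossing of its
  own (\<open>card_odd_pairs_le_virtual_crossings\<close>).  In \<open>L(n)\<close> the longitude is oddly linked
  with each of the \<open>n\<close> meridians.  As the virtual crossing numbers differ, so do the links.

  The evenness comes from the winding number of the second curve around a point that moves along the
  first one: it is locally constant away from the crossings, changes by \<open>\<plusminus>1\<close> at each
  of them (\<open>winding_number_jump\<close>), and returns to its initial value.

  For the representation in the thickened torus one needs an orientation-preserving immersion of a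
  neighbourhood of the projected link (the punctured torus immerses in the plane, the torus does
  not).  The formula \<open>torus_map\<close> is explicit, and the neighbourhood is simply taken to be the set
  where its Jacobian determinant is positive.\<close>

section \<open>Winding numbers of perturbed arcs\<close>

lemma winding_number_convex_eq_linepath:
  assumes "path \<gamma>" "path_image \<gamma> \<subseteq> C" "convex C" "z \<notin> C"
  shows "winding_number \<gamma> z = winding_number (linepath (pathstart \<gamma>) (pathfinish \<gamma>)) z"
proof (rule winding_number_paths_linear_eq)
  fix t :: real assume t: "t \<in> {0..1}"
  have "pathstart \<gamma> \<in> C" "pathfinish \<gamma> \<in> C" "\<gamma> t \<in> C"
    using assms(2) t pathstart_in_path_image[of \<gamma>] pathfinish_in_path_image[of \<gamma>]
    unfolding path_image_def by blast+
  then have "linepath (pathstart \<gamma>) (pathfinish \<gamma>) t \<in> C"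
    using assms(3) t linepath_in_path[of t "pathstart \<gamma>" "pathfinish \<gamma>"] closed_segment_subset by blast
  with \<open>\<gamma> t \<in> C\<close> show "z \<notin> closed_segment (linepath (pathstart \<gamma>) (pathfinish \<gamma>) t) (\<gamma> t)"
    using assms(3,4) closed_segment_subset by blast
qed (use assms in auto)

text \<open>An arc that turns from one convex set into another may be rerouted through any common point
  \<open>q\<close> of the two, as seen from a point outside both.  Below, the arc is a short piece of a curve around a
  crossing and \<open>q\<close> lies beside it, on the far side from \<open>z\<close>; rerouting clears the crossing, so that
  \<open>z\<close> can then be moved into it.\<close>

lemma winding_number_bent_arc:
  assumes \<mu>: "path \<mu>" "path_image \<mu> \<subseteq> C" "convex C" "z \<notin> C"
    and \<nu>: "path \<nu>" "path_image \<nu> \<subseteq> E" "convex E" "z \<notin> E"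
    and mid: "pathfinish \<mu> = pathstart \<nu>" and q: "q \<in> C" "q \<in> E"
  shows "winding_number \<mu> z + winding_number \<nu> z =
         winding_number (linepath (pathstart \<mu>) q) z + winding_number (linepath q (pathfinish \<nu>)) z"
proof -
  let ?m = "pathstart \<nu>"
  have ends: "pathstart \<mu> \<in> C" "?m \<in> C" "?m \<in> E" "pathfinish \<nu> \<in> E"
    using \<mu>(2) \<nu>(2) mid pathstart_in_path_image[of \<mu>] pathfinish_in_path_image[of \<mu>]
      pathstart_in_path_image[of \<nu>] pathfinish_in_path_image[of \<nu>] by auto
  have seg: "closed_segment ?m q \<subseteq> C" "closed_segment q ?m \<subseteq> E"
    using ends q \<mu>(3) \<nu>(3) closed_segment_subset by blast+
  have zmq: "z \<notin> closed_segment ?m q" "z \<notin> closed_segment q ?m"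
    using seg \<mu>(4) \<nu>(4) by auto
  have z\<mu>: "z \<notin> path_image \<mu>" and z\<nu>: "z \<notin> path_image \<nu>" using \<mu> \<nu> by auto
  have rev: "winding_number (linepath q ?m) z = - winding_number (linepath ?m q) z"
    using winding_number_reversepath[of "linepath ?m q" z] zmq by simp
  have "winding_number \<mu> z + winding_number (linepath ?m q) z = winding_number (\<mu> +++ linepath ?m q) z"
    using \<mu> mid z\<mu> zmq by (intro winding_number_join[symmetric]) auto
  also have "\<dots> = winding_number (linepath (pathstart \<mu>) q) z"
    using winding_number_convex_eq_linepath[of "\<mu> +++ linepath ?m q" C z] seg \<mu> mid
    by (auto simp: path_image_join)
  finally have left: "winding_number (linepath (pathstart \<mu>) q) z = winding_number \<mu> z + winding_number (linepath ?m q) z" ..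
  have "winding_number (linepath q ?m) z + winding_number \<nu> z = winding_number (linepath q ?m +++ \<nu>) z"
    using \<nu> z\<nu> zmq by (intro winding_number_join[symmetric]) auto
  also have "\<dots> = winding_number (linepath q (pathfinish \<nu>)) z"
    using winding_number_convex_eq_linepath[of "linepath q ?m +++ \<nu>" E z] seg \<nu> mid
    by (auto simp: path_image_join)
  finally have right: "winding_number (linepath q (pathfinish \<nu>)) z = winding_number (linepath q ?m) z + winding_number \<nu> z" ..
  show ?thesis unfolding left right rev by simp
qed

lemma winding_number_linepath_commute:
  assumes "z \<notin> closed_segment u v"
  shows "winding_number (linepath v u) z = - winding_number (linepath u v) z"
  using winding_number_reversepath[of "linepath u v" z] assms by simp

lemma linepath_avoids:
  assumes "0 < Im ((v - u) * cnj (v - z))"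
  shows "z \<notin> closed_segment u v"
  using assms by (simp add: closed_segment_def) (force simp: algebra_simps)

text \<open>The four sides are seen from \<open>z\<close> under positive angles, each smaller than \<open>\<pi>\<close>.  Their sum is
  a positive multiple of \<open>2\<pi>\<close> below \<open>4\<pi>\<close>.\<close>

lemma winding_number_quadrilateral:
  assumes "0 < Im ((b - a) * cnj (b - z))" "0 < Im ((c - b) * cnj (c - z))"
    "0 < Im ((d - c) * cnj (d - z))" "0 < Im ((a - d) * cnj (a - z))"
  shows "winding_number (linepath a b) z + winding_number (linepath b c) z +
         winding_number (linepath c d) z + winding_number (linepath d a) z = 1"
proof -
  note s = assms[THEN linepath_avoids]
  let ?w = "\<lambda>u v. winding_number (linepath u v) z"
  let ?p = "linepath a b +++ linepath b c +++ linepath c d +++ linepath d a"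
  have eq: "winding_number ?p z = ?w a b + (?w b c + (?w c d + ?w d a))"
    using s by (simp add: winding_number_join path_image_join)
  have "winding_number ?p z \<in> \<int>"
    using s by (intro integer_winding_number) (auto simp: path_image_join)
  then obtain k :: int where k: "winding_number ?p z = of_int k" by (elim Ints_cases)
  have pos: "0 < Re (?w a b)" "0 < Re (?w b c)" "0 < Re (?w c d)" "0 < Re (?w d a)"
    using assms by (simp_all add: winding_number_linepath_pos_lt)
  have lt: "Re (?w a b) < 1/2" "Re (?w b c) < 1/2" "Re (?w c d) < 1/2" "Re (?w d a) < 1/2"
    using s[THEN winding_number_lt_half_linepath] by auto
  have "real_of_int k = Re (?w a b) + (Re (?w b c) + (Re (?w c d) + Re (?w d a)))"
    using k eq by (metis Re_complex_of_real of_real_of_int_eq plus_complex.sel(1))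
  then have "0 < real_of_int k" "real_of_int k < 2" using pos lt by linarith+
  then have "k = 1" by linarith
  with k eq show ?thesis by (simp add: add.assoc)
qed

lemma winding_number_eventually_eq:
  assumes "path \<gamma>" "pathfinish \<gamma> = pathstart \<gamma>" "p \<notin> path_image \<gamma>"
  shows "\<forall>\<^sub>F z in nhds p. z \<notin> path_image \<gamma> \<and> winding_number \<gamma> z = winding_number \<gamma> p"
proof -
  have op: "open (- path_image \<gamma>)" using assms(1) by (simp add: closed_path_image open_Compl)
  then obtain r where r: "0 < r" "ball p r \<subseteq> - path_image \<gamma>"
    using openE assms(3) by blast
  have "z \<notin> path_image \<gamma> \<and> winding_number \<gamma> z = winding_number \<gamma> p" if "z \<in> ball p r" for z
    using winding_number_eq[OF assms(1,2) that, of p] that r by auto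
  moreover have "\<forall>\<^sub>F z in nhds p. z \<in> ball p r"
    using eventually_nhds_in_open[of "ball p r" p] r(1) by simp
  ultimately show ?thesis by (rule eventually_mono[rotated])
qed

lemma winding_number_detour_locally_constant:
  assumes "path \<Gamma>" "p \<notin> path_image \<Gamma>" "pathstart \<Gamma> = v" "pathfinish \<Gamma> = u"
    and q: "p \<notin> closed_segment u q" "p \<notin> closed_segment q v"
  defines "w \<equiv> \<lambda>z. winding_number (linepath u q) z + winding_number (linepath q v) z + winding_number \<Gamma> z"
  shows "\<forall>\<^sub>F z in nhds p. w z = w p"
proof -
  let ?L = "(linepath u q +++ linepath q v) +++ \<Gamma>"
  have L: "path ?L" "pathfinish ?L = pathstart ?L" using assms by auto
  have im: "path_image ?L = (closed_segment u q \<union> closed_segment q v) \<union> path_image \<Gamma>"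
    using assms by (simp add: path_image_join)
  have eq: "winding_number ?L z = w z" if "z \<notin> path_image ?L" for z
    using that assms(1-4) unfolding im w_def by (simp add: winding_number_join path_image_join)
  have p: "p \<notin> path_image ?L" unfolding im using assms by auto
  show ?thesis
    using winding_number_eventually_eq[OF L p]
  proof (rule eventually_mono)
    fix z assume z: "z \<notin> path_image ?L \<and> winding_number ?L z = winding_number ?L p"
    then have "winding_number ?L z = w z" "winding_number ?L z = winding_number ?L p"
      using eq by blast+
    then show "w z = w p" unfolding eq[OF p] by metis
  qed
qed

text \<open>Closed curves are treated as functions on the line of period \<open>2\<pi>\<close>.\<close>

lemma periodic_int:
  fixes \<beta> :: "real \<Rightarrow> 'a" and n :: int
  assumes "\<And>t. \<beta> (t + 2 * pi) = \<beta> t"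
  shows "\<beta> (t + 2 * pi * of_int n) = \<beta> t"
proof -
  interpret periodic_fun_simple \<beta> "2 * pi" by unfold_locales (rule assms)
  show ?thesis using plus_of_int[of t n] by (simp add: mult.commute)
qed

lemma periodic_range:
  fixes \<beta> :: "real \<Rightarrow> 'a"
  assumes "\<And>t. \<beta> (t + 2 * pi) = \<beta> t"
  shows "range \<beta> = \<beta> ` {c..<c + 2 * pi}"
proof -
  have "\<beta> t \<in> \<beta> ` {c..<c + 2 * pi}" for t
  proof -
    define n where "n = - \<lfloor>(t - c) / (2 * pi)\<rfloor>"
    have "of_int \<lfloor>(t - c) / (2 * pi)\<rfloor> \<le> (t - c) / (2 * pi)" "(t - c) / (2 * pi) < of_int \<lfloor>(t - c) / (2 * pi)\<rfloor> + 1"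
      by linarith+
    then have "t + 2 * pi * of_int n \<in> {c..<c + 2 * pi}"
      unfolding n_def by (simp add: le_divide_eq divide_less_eq algebra_simps)
    then show ?thesis using periodic_int[of \<beta> t n] assms by (metis imageI)
  qed
  then show ?thesis by blast
qed

lemma winding_number_periodic_basepoint:
  fixes \<beta> :: "real \<Rightarrow> complex"
  assumes cont: "continuous_on UNIV \<beta>" and per: "\<And>t. \<beta> (t + 2 * pi) = \<beta> t" and z: "z \<notin> range \<beta>"
  shows "winding_number (\<lambda>u. \<beta> (c + 2 * pi * u)) z = winding_number (\<lambda>u. \<beta> (d + 2 * pi * u)) z"
proof (rule winding_number_homotopic_loops)
  show "homotopic_loops (- {z}) (\<lambda>u. \<beta> (c + 2 * pi * u)) (\<lambda>u. \<beta> (d + 2 * pi * u))"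
    unfolding homotopic_loops
  proof (intro exI conjI ballI)
    let ?h = "\<lambda>y. \<beta> ((1 - fst y) * c + fst y * d + 2 * pi * snd y)"
    show "continuous_on ({0..1} \<times> {0..1}) ?h"
      by (intro continuous_on_compose2[OF cont] continuous_intros) auto
    show "?h \<in> {0..1} \<times> {0..1} \<rightarrow> - {z}" using z by auto
    show "pathfinish (?h \<circ> Pair t) = pathstart (?h \<circ> Pair t)" for t
      using per[of "(1 - t) * c + t * d"] by (simp add: pathfinish_def pathstart_def)
  qed auto
qed

text \<open>Near \<open>s\<close> a curve stays in the double cone around its tangent; in coordinates \<open>F\<close> and \<open>G\<close>
  along and across the tangent, this is an inequality.\<close>

lemma derivative_in_cone:
  fixes \<gamma> :: "real \<Rightarrow> complex"
  assumes der: "(\<gamma> has_vector_derivative d) (at s)"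
    and lin: "linear F" "linear G" and d: "F d = (1::real)" "G d = (0::real)"
  shows "\<exists>\<epsilon>>0. \<forall>t. 0 < \<bar>t - s\<bar> \<and> \<bar>t - s\<bar> < \<epsilon> \<longrightarrow>
     \<bar>G (\<gamma> t - \<gamma> s)\<bar> < sgn (t - s) * F (\<gamma> t - \<gamma> s)"
proof -
  obtain K where K: "K > 0" "\<And>x. \<bar>F x\<bar> \<le> norm x * K"
    using bounded_linear.pos_bounded[of F] lin(1) by (auto simp: linear_linear)
  obtain L where L: "L > 0" "\<And>x. \<bar>G x\<bar> \<le> norm x * L"
    using bounded_linear.pos_bounded[of G] lin(2) by (auto simp: linear_linear)
  define e where "e = 1 / (2 * (K + L))"
  have e: "e > 0" using K L by (simp add: e_def)
  have half: "e * K + e * L = 1/2"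
  proof -
    have "e * K + e * L = e * (K + L)" by (simp add: algebra_simps)
    then show ?thesis using K L by (simp add: e_def)
  qed
  obtain \<epsilon> where \<epsilon>: "\<epsilon> > 0" "\<And>t. \<bar>t - s\<bar> < \<epsilon> \<Longrightarrow> norm (\<gamma> t - \<gamma> s - (t - s) *\<^sub>R d) \<le> e * \<bar>t - s\<bar>"
    using der e unfolding has_vector_derivative_def has_derivative_at_alt by (auto simp: real_norm_def)
  have "\<bar>G (\<gamma> t - \<gamma> s)\<bar> < sgn (t - s) * F (\<gamma> t - \<gamma> s)" if t: "0 < \<bar>t - s\<bar>" "\<bar>t - s\<bar> < \<epsilon>" for t
  proof -
    define h r where "h = t - s" and "r = \<gamma> t - \<gamma> s - (t - s) *\<^sub>R d"
    have eq: "\<gamma> t - \<gamma> s = h *\<^sub>R d + r" by (simp add: r_def h_def)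
    have r: "norm r \<le> e * \<bar>h\<bar>" using \<epsilon>(2)[OF t(2)] by (simp add: r_def h_def)
    have G: "G (\<gamma> t - \<gamma> s) = G r" and F: "F (\<gamma> t - \<gamma> s) = h + F r"
      unfolding eq using lin d by (simp_all add: linear_add linear_scale)
    have "\<bar>G r\<bar> \<le> e * \<bar>h\<bar> * L" "\<bar>F r\<bar> \<le> e * \<bar>h\<bar> * K"
      using K L r by (meson mult_right_mono less_imp_le order_trans)+
    then have "\<bar>G r\<bar> + \<bar>F r\<bar> \<le> (e * K + e * L) * \<bar>h\<bar>" by (simp add: algebra_simps)
    then have "\<bar>G r\<bar> + \<bar>F r\<bar> < \<bar>h\<bar>" using half t by (simp add: h_def)
    then show ?thesis unfolding G F h_def[symmetric] by (auto simp: sgn_if)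
  qed
  with \<epsilon>(1) show ?thesis by blast
qed

lemma convex_linear_halfspace:
  assumes "linear (f :: complex \<Rightarrow> real)"
  shows "convex {z. f (z - p) \<le> 0}"
proof (rule convexI)
  fix x y :: complex and u v :: real
  assume *: "x \<in> {z. f (z - p) \<le> 0}" "y \<in> {z. f (z - p) \<le> 0}" "0 \<le> u" "0 \<le> v" "u + v = 1"
  have "u *\<^sub>R x + v *\<^sub>R y - p = u *\<^sub>R (x - p) + v *\<^sub>R (y - p)"
    using *(5) by (simp add: algebra_simps flip: scaleR_left.add)
  then have "f (u *\<^sub>R x + v *\<^sub>R y - p) = u * f (x - p) + v * f (y - p)"
    using assms by (simp add: linear_add linear_scale)
  also have "\<dots> \<le> 0" using * by (simp add: add_nonpos_nonpos mult_nonneg_nonpos)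
  finally show "u *\<^sub>R x + v *\<^sub>R y \<in> {z. f (z - p) \<le> 0}" by simp
qed

text \<open>\<open>X\<close> and \<open>Y\<close> are oblique coordinates around \<open>p\<close>.  Near \<open>p\<close> the curve lies in the double cone
  \<open>\<bar>Y\<bar> \<le> \<bar>X\<bar>\<close> and \<open>z\<close> in the upper half of the complementary one.
  The two convex sets of \<open>winding_number_bent_arc\<close> are the left and the right half plane, each
  cut off below the cone of \<open>z\<close>; both contain \<open>p - a\<close>.\<close>

lemma winding_number_beside_arc:
  fixes \<beta> :: "real \<Rightarrow> complex" and X Y :: "complex \<Rightarrow> real"
  assumes cont: "continuous_on UNIV \<beta>" and per: "\<And>t. \<beta> (t + 2 * pi) = \<beta> t"
    and lin: "linear X" "linear Y" and a: "X a = 0" "Y a = 1"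
    and \<delta>: "0 < \<delta>" "\<delta> < pi"
    and L: "\<And>t. t0 - \<delta> \<le> t \<Longrightarrow> t \<le> t0 \<Longrightarrow> \<bar>Y (\<beta> t - p)\<bar> \<le> - X (\<beta> t - p)"
    and R: "\<And>t. t0 \<le> t \<Longrightarrow> t \<le> t0 + \<delta> \<Longrightarrow> \<bar>Y (\<beta> t - p)\<bar> \<le> X (\<beta> t - p)"
    and z: "z \<notin> range \<beta>" "\<bar>X (z - p)\<bar> < Y (z - p)"
  defines "g \<equiv> \<lambda>u. \<beta> (t0 - \<delta> + 2 * pi * u)"
  shows "winding_number g z =
    winding_number (linepath (\<beta> (t0 - \<delta>)) (p - a)) z + winding_number (linepath (p - a) (\<beta> (t0 + \<delta>))) z +
    winding_number (subpath (\<delta> / pi) 1 g) z"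
proof -
  define v where "v = \<delta> / (2 * pi)"
  have v: "0 < v" "v < 1/2" "2 * v = \<delta> / pi" "2 * pi * v = \<delta>" using \<delta> by (auto simp: v_def field_simps)
  have g: "path g" unfolding path_def g_def
    by (intro continuous_on_compose2[OF cont] continuous_intros) auto
  have zg: "z \<notin> path_image g" using z by (auto simp: path_image_def g_def)
  define C where "C = {z. X (z - p) \<le> 0} \<inter> {z. Y (z - p) + X (z - p) \<le> 0}"
  define E where "E = {z. - X (z - p) \<le> 0} \<inter> {z. Y (z - p) - X (z - p) \<le> 0}"
  have "convex C" unfolding C_def
    using convex_linear_halfspace[of X p] convex_linear_halfspace[of "\<lambda>z. Y z + X z" p] lin
    by (intro convex_Int) (auto intro: linear_compose_add)
  have "convex E" unfolding E_def
    using convex_linear_halfspace[of "\<lambda>z. - X z" p] convex_linear_halfspace[of "\<lambda>z. Y z - X z" p] lin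
    by (intro convex_Int) (auto intro: linear_compose_sub linear_compose_neg)
  have "z \<notin> C" "z \<notin> E" using z by (auto simp: C_def E_def)
  have "p - a - p = - a" by simp
  then have q: "p - a \<in> C" "p - a \<in> E" using a lin by (auto simp: C_def E_def linear_neg)
  have "path_image (subpath 0 v g) \<subseteq> C"
  proof -
    have "g u \<in> C" if "u \<in> {0..v}" for u
    proof -
      have "2 * pi * u \<le> \<delta>" using that v by (metis atLeastAtMost_iff mult_left_mono pi_ge_zero mult_nonneg_nonneg zero_le_numeral)
      then have "\<bar>Y (g u - p)\<bar> \<le> - X (g u - p)" unfolding g_def using that by (intro L) auto
      then show ?thesis by (auto simp: C_def)
    qed
    then show ?thesis using v by (auto simp: path_image_subpath)
  qed
  moreover have "path_image (subpath v (2 * v) g) \<subseteq> E"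
  proof -
    have "g u \<in> E" if "u \<in> {v..2 * v}" for u
    proof -
      have "2 * pi * v \<le> 2 * pi * u" "2 * pi * u \<le> 2 * pi * (2 * v)"
        using that by (intro mult_left_mono; simp)+
      then have "\<delta> \<le> 2 * pi * u" "2 * pi * u \<le> 2 * \<delta>" using v(4) by linarith+
      then have "\<bar>Y (g u - p)\<bar> \<le> X (g u - p)" unfolding g_def using that by (intro R) auto
      then show ?thesis by (auto simp: E_def)
    qed
    then show ?thesis using v(1) by (auto simp: path_image_subpath)
  qed
  ultimately have "winding_number (subpath 0 v g) z + winding_number (subpath v (2 * v) g) z =
    winding_number (linepath (g 0) (p - a)) z + winding_number (linepath (p - a) (g (2 * v))) z"
    using winding_number_bent_arc[of "subpath 0 v g" C z "subpath v (2 * v) g" E "p - a"]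
      g v(1,2) \<open>convex C\<close> \<open>convex E\<close> \<open>z \<notin> C\<close> \<open>z \<notin> E\<close> q by simp
  moreover have "winding_number (subpath 0 v g) z + winding_number (subpath v (2 * v) g) z =
      winding_number (subpath 0 (2 * v) g) z"
    using v(1,2) by (intro winding_number_subpath_combine g zg) auto
  moreover have "winding_number (subpath 0 (2 * v) g) z + winding_number (subpath (2 * v) 1 g) z =
      winding_number (subpath 0 1 g) z"
    using v(1,2) by (intro winding_number_subpath_combine g zg) auto
  moreover have "g (2 * v) = \<beta> (t0 + \<delta>)"
  proof -
    have "t0 - \<delta> + 2 * pi * (2 * v) = t0 + \<delta>" using v(4) by linarith
    then show ?thesis unfolding g_def by (rule arg_cong)
  qed
  moreover have "g 0 = \<beta> (t0 - \<delta>)" by (simp add: g_def)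
  ultimately show ?thesis using v(3) by simp
qed

section \<open>The jump of the winding number at a crossing\<close>

text \<open>Just after the crossing the curve \<open>\<beta>\<close> can be rerouted through \<open>p - a\<close>, and just before
  it through \<open>p + a\<close>.  Both rerouted curves avoid the crossing point \<open>p\<close>, so the winding numbers
  can be taken at \<open>p\<close> itself.  Their difference is the winding number of the
  quadrilateral with vertices \<open>\<beta>(t\<^sub>0 - \<delta>)\<close>, \<open>p - a\<close>, \<open>\<beta>(t\<^sub>0 + \<delta>)\<close>, \<open>p + a\<close>.\<close>

lemma winding_number_jump:
  fixes \<alpha> \<beta> :: "real \<Rightarrow> complex"
  assumes cont: "continuous_on UNIV \<beta>" and per: "\<And>t. \<beta> (t + 2 * pi) = \<beta> t"
    and \<alpha>: "(\<alpha> has_vector_derivative a) (at s0)" and \<beta>: "(\<beta> has_vector_derivative b) (at t0)"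
    and cross: "\<alpha> s0 = \<beta> t0" and once: "\<And>t. t0 < t \<Longrightarrow> t < t0 + 2 * pi \<Longrightarrow> \<beta> t \<noteq> \<beta> t0"
    and transverse: "Im (cnj b * a) \<noteq> 0"
  defines "W \<equiv> winding_number (\<lambda>u. \<beta> (2 * pi * u))"
  obtains k l where "\<forall>\<^sub>F s in at_left s0. \<alpha> s \<notin> range \<beta> \<and> W (\<alpha> s) = k"
    "\<forall>\<^sub>F s in at_right s0. \<alpha> s \<notin> range \<beta> \<and> W (\<alpha> s) = l"
    "l = k + 1 \<or> l = k - 1"
proof -
  define p where "p = \<beta> t0"
  define D where "D = Im (cnj b * a)"
  define X Y where "X = (\<lambda>z. Im (cnj z * a) / D)" and "Y = (\<lambda>z. Im (cnj b * z) / D)"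
  have lin: "linear X" "linear Y"
    unfolding X_def Y_def by (auto intro!: linearI simp: algebra_simps add_divide_distrib diff_divide_distrib)
  have XY: "X a = 0" "Y a = 1" "X b = 1" "Y b = 0"
    using transverse by (simp_all add: X_def Y_def D_def mult.commute)
  obtain \<delta>0 where \<delta>0: "\<delta>0 > 0" "\<And>t. 0 < \<bar>t - t0\<bar> \<Longrightarrow> \<bar>t - t0\<bar> < \<delta>0 \<Longrightarrow>
      \<bar>Y (\<beta> t - p)\<bar> < sgn (t - t0) * X (\<beta> t - p)"
    using derivative_in_cone[OF \<beta> lin XY(3,4)] p_def by blast
  define \<delta> where "\<delta> = min (\<delta>0 / 2) 1"
  have \<delta>: "0 < \<delta>" "\<delta> < \<delta>0" "\<delta> < pi" using \<delta>0(1) pi_gt3 by (auto simp: \<delta>_def)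
  have X0: "X 0 = 0" "Y 0 = 0" using lin by (auto simp: linear_0)
  have Ls: "\<bar>Y (\<beta> t - p)\<bar> < - X (\<beta> t - p)" if "t0 - \<delta> \<le> t" "t < t0" for t
    using \<delta>0(2)[of t] that \<delta> by (simp add: sgn_if)
  have Rs: "\<bar>Y (\<beta> t - p)\<bar> < X (\<beta> t - p)" if "t0 < t" "t \<le> t0 + \<delta>" for t
    using \<delta>0(2)[of t] that \<delta> by (simp add: sgn_if)
  have L: "\<bar>Y (\<beta> t - p)\<bar> \<le> - X (\<beta> t - p)" if "t0 - \<delta> \<le> t" "t \<le> t0" for t
    using Ls[of t] that X0 by (cases "t = t0") (auto simp: p_def)
  have R: "\<bar>Y (\<beta> t - p)\<bar> \<le> X (\<beta> t - p)" if "t0 \<le> t" "t \<le> t0 + \<delta>" for t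
    using Rs[of t] that X0 by (cases "t = t0") (auto simp: p_def)
  define u v where "u = \<beta> (t0 - \<delta>)" and "v = \<beta> (t0 + \<delta>)"
  define g where "g = (\<lambda>u. \<beta> (t0 - \<delta> + 2 * pi * u))"
  define \<Gamma> where "\<Gamma> = subpath (\<delta> / pi) 1 g"
  have v01: "\<delta> / pi \<in> {0..1}" using \<delta> by simp
  have g: "path g" unfolding path_def g_def
    by (intro continuous_on_compose2[OF cont] continuous_intros) auto
  have ends: "pathstart \<Gamma> = v" "pathfinish \<Gamma> = u"
    using per[of "t0 - \<delta>"] by (simp_all add: \<Gamma>_def g_def u_def v_def add.commute[of t0 \<delta>])
  have far: "path_image \<Gamma> = \<beta> ` {t0 + \<delta>..t0 - \<delta> + 2 * pi}"
  proof -
    have "path_image \<Gamma> = \<beta> ` ((\<lambda>u. t0 - \<delta> + 2 * pi * u) ` {\<delta> / pi..1})"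
      using v01 by (auto simp: \<Gamma>_def path_image_subpath g_def image_image)
    also have "(\<lambda>u. t0 - \<delta> + 2 * pi * u) ` {\<delta> / pi..1} = {t0 + \<delta>..t0 - \<delta> + 2 * pi}"
      using v01 image_affinity_atLeastAtMost[of "2 * pi" "t0 - \<delta>" "\<delta> / pi" 1]
      by (simp add: algebra_simps)
    finally show ?thesis .
  qed
  have \<Gamma>: "path \<Gamma>" unfolding \<Gamma>_def using g v01 by simp
  have pfar: "p \<notin> path_image \<Gamma>"
    unfolding far using once \<delta> by (force simp: p_def)
  \<comment> \<open>the winding number of \<open>\<beta>\<close> rerouted through \<open>q\<close>\<close>
  define w where "w = (\<lambda>q z. winding_number (linepath u q) z + winding_number (linepath q v) z + winding_number \<Gamma> z)"
  have Wg: "W z = winding_number g z" if "z \<notin> range \<beta>" for z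
    using winding_number_periodic_basepoint[OF cont per that, of 0 "t0 - \<delta>"] by (simp add: W_def g_def)
  have W: "W z = w (p - c * a) z" if "c \<in> {1, -1}" "z \<notin> range \<beta>" "\<bar>X (z - p)\<bar> < c * Y (z - p)"
    for c :: real and z
  proof -
    have "linear (\<lambda>z. c * Y z)" using lin(2) by (intro linearI) (simp_all add: linear_add linear_scale algebra_simps)
    moreover have "c * Y (c * a) = 1" "X (c * a) = 0"
      using that(1) XY lin by (auto simp: linear_neg)
    moreover have "\<bar>c * Y z\<bar> = \<bar>Y z\<bar>" for z using that(1) by auto
    ultimately show ?thesis
      unfolding Wg[OF that(2)] g_def w_def u_def v_def \<Gamma>_def
      using winding_number_beside_arc[OF cont per lin(1), of "\<lambda>z. c * Y z" "c * a" \<delta> t0 p z] \<delta> L R that(2,3)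
      by simp
  qed
  \<comment> \<open>The sign of the crossing decides in which order \<open>p - a\<close> and \<open>p + a\<close> are
    passed counterclockwise.\<close>
  define s where "s = sgn D"
  have s: "s = 1 \<or> s = -1" "s * D > 0" using transverse by (auto simp: s_def D_def sgn_if)
  have Xuv: "X (u - p) < 0" "X (v - p) > 0"
    using Ls[of "t0 - \<delta>"] Rs[of "t0 + \<delta>"] \<delta> by (auto simp: u_def v_def)
  have ImX: "Im (cnj z * a) = D * X z" for z using transverse by (simp add: X_def D_def)
  have i1: "Im (((p - s*a) - u) * cnj ((p - s*a) - p)) = - (s * D) * X (u - p)"
    using ImX[of "u - p"] s(1) by (auto simp: algebra_simps)
  have i2: "Im ((v - (p - s*a)) * cnj (v - p)) = (s * D) * X (v - p)"
    using ImX[of "v - p"] s(1) by (auto simp: algebra_simps)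
  have i3: "Im (((p + s*a) - v) * cnj ((p + s*a) - p)) = (s * D) * X (v - p)"
    using ImX[of "v - p"] s(1) by (auto simp: algebra_simps)
  have i4: "Im ((u - (p + s*a)) * cnj (u - p)) = - (s * D) * X (u - p)"
    using ImX[of "u - p"] s(1) by (auto simp: algebra_simps)
  have pos: "0 < - (s * D) * X (u - p)" "0 < (s * D) * X (v - p)"
    using s(2) Xuv by (auto simp: mult_neg_neg mult_pos_neg)
  have P: "0 < Im (((p - s*a) - u) * cnj ((p - s*a) - p))" "0 < Im ((v - (p - s*a)) * cnj (v - p))"
    "0 < Im (((p + s*a) - v) * cnj ((p + s*a) - p))" "0 < Im ((u - (p + s*a)) * cnj (u - p))"
    unfolding i1 i2 i3 i4 using pos by auto
  note av = P[THEN linepath_avoids]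
  have sum1: "w (p - s*a) p - w (p + s*a) p = 1"
  proof -
    have "winding_number (linepath u (p - s*a)) p + winding_number (linepath (p - s*a) v) p +
       winding_number (linepath v (p + s*a)) p + winding_number (linepath (p + s*a) u) p = 1"
      using winding_number_quadrilateral[OF P] .
    then show ?thesis
      using winding_number_linepath_commute[OF av(3)] winding_number_linepath_commute[OF av(4)]
      unfolding w_def by (simp add: algebra_simps)
  qed
  have av': "p \<notin> closed_segment u (p - c*a)" "p \<notin> closed_segment (p - c*a) v" if "c \<in> {1, -1}" for c :: real
    using av s(1) that by (auto simp: closed_segment_commute)
  have loc: "\<forall>\<^sub>F z in nhds p. w (p - c*a) z = w (p - c*a) p" if "c \<in> {1, -1}" for c :: real
    using winding_number_detour_locally_constant[OF \<Gamma> pfar ends av'[OF that]] unfolding w_def .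
  have lim: "filterlim \<alpha> (nhds p) (at s0 within A)" for A
    using has_vector_derivative_continuous[OF \<alpha>] cross
    by (auto simp: p_def continuous_within intro: tendsto_within_subset)
  have "\<forall>\<^sub>F z in nhds p. z \<notin> path_image \<Gamma>"
    using eventually_nhds_in_open[of "- path_image \<Gamma>" p] pfar \<Gamma>
    by (simp add: closed_path_image open_Compl)
  then have offfar: "\<forall>\<^sub>F s in at s0 within A. \<alpha> s \<notin> path_image \<Gamma>" for A
    by (rule eventually_compose_filterlim[OF _ lim])
  obtain \<epsilon> where \<epsilon>: "\<epsilon> > 0" "\<And>t. 0 < \<bar>t - s0\<bar> \<Longrightarrow> \<bar>t - s0\<bar> < \<epsilon> \<Longrightarrow>
      \<bar>X (\<alpha> t - p)\<bar> < sgn (t - s0) * Y (\<alpha> t - p)"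
    using derivative_in_cone[OF \<alpha> lin(2,1) XY(2,1)] unfolding cross p_def[symmetric] by blast
  have off: "\<alpha> t \<notin> range \<beta>" if t: "0 < \<bar>t - s0\<bar>" "\<bar>t - s0\<bar> < \<epsilon>" "\<alpha> t \<notin> path_image \<Gamma>" for t
  proof
    assume "\<alpha> t \<in> range \<beta>"
    then obtain r where r: "r \<in> {t0 - \<delta>..<t0 - \<delta> + 2 * pi}" "\<alpha> t = \<beta> r"
      using periodic_range[of \<beta> "t0 - \<delta>", OF per] by auto
    have "r \<le> t0 + \<delta>" using r t(3) unfolding far by force
    then have "\<bar>Y (\<alpha> t - p)\<bar> \<le> \<bar>X (\<alpha> t - p)\<bar>"
      using L[of r] R[of r] r by (cases "r \<le> t0") auto
    moreover have "\<bar>X (\<alpha> t - p)\<bar> < \<bar>Y (\<alpha> t - p)\<bar>"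
      using \<epsilon>(2)[OF t(1,2)] by (auto simp: sgn_if split: if_splits)
    ultimately show False by simp
  qed
  have side: "\<forall>\<^sub>F t in at s0 within A. \<alpha> t \<notin> range \<beta> \<and> W (\<alpha> t) = w (p - c*a) p"
    if c: "c \<in> {1, -1}" and A: "\<And>t. t \<in> A \<Longrightarrow> t \<noteq> s0 \<Longrightarrow> sgn (t - s0) = c" for A c
  proof -
    have "\<forall>\<^sub>F t in at s0 within A. w (p - c*a) (\<alpha> t) = w (p - c*a) p"
      by (rule eventually_compose_filterlim[OF loc[OF c] lim])
    moreover have "\<forall>\<^sub>F t in at s0 within A. t \<in> A \<and> t \<noteq> s0 \<and> \<bar>t - s0\<bar> < \<epsilon>"
      using \<epsilon>(1) by (auto simp: eventually_at dist_real_def)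
    ultimately show ?thesis using offfar
    proof eventually_elim
      case (elim t)
      then have "0 < \<bar>t - s0\<bar>" by simp
      then show ?case using W[OF c, of "\<alpha> t"] off[of t] \<epsilon>(2)[of t] A[of t] elim by auto
    qed
  qed
  show ?thesis
  proof (rule that)
    show "\<forall>\<^sub>F t in at_left s0. \<alpha> t \<notin> range \<beta> \<and> W (\<alpha> t) = w (p + a) p"
      using side[of "-1" "{..<s0}"] by simp
    show "\<forall>\<^sub>F t in at_right s0. \<alpha> t \<notin> range \<beta> \<and> W (\<alpha> t) = w (p - a) p"
      using side[of 1 "{s0<..}"] by simp
    show "w (p - a) p = w (p + a) p + 1 \<or> w (p - a) p = w (p + a) p - 1"
      using sum1 s(1) by (auto simp: algebra_simps)
  qed
qed

section \<open>Closed plane curves cross an even number of times\<close>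

text \<open>A function that is constant between the points of \<open>S\<close> and has odd jumps exactly there changes its
  parity once per point.  Replacing \<open>f\<close> by its left limit gives it a value at the points of \<open>S\<close>
  too, which makes the parity count additive over adjacent half-open intervals; on small
  intervals it is clear.\<close>

lemma even_card_jumps:
  fixes f :: "real \<Rightarrow> int" and S :: "real set"
  assumes jump: "\<And>s. \<exists>k l. (\<forall>\<^sub>F r in at_left s. r \<notin> S \<and> f r = k) \<and>
        (\<forall>\<^sub>F r in at_right s. r \<notin> S \<and> f r = l) \<and> (odd (l - k) \<longleftrightarrow> s \<in> S)"
    and per: "\<And>s. f (s + p) = f s" and p: "p > 0"
  shows "even (card (S \<inter> {0..<p}))"
proof -
  define w where "w s = (THE k. \<forall>\<^sub>F r in at_left s. f r = k)" for s
  have wI: "w s = k" if "\<forall>\<^sub>F r in at_left s. f r = k" for s k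
    unfolding w_def
  proof (rule the_equality)
    show "\<forall>\<^sub>F r in at_left s. f r = k" by (rule that)
    fix k' assume "\<forall>\<^sub>F r in at_left s. f r = k'"
    then have "\<forall>\<^sub>F r in at_left s. k' = k" using that by eventually_elim simp
    then show "k' = k" by simp
  qed
  have near: "\<exists>\<epsilon>>0. \<forall>c d. c \<le> s \<and> s \<le> d \<and> d - c < \<epsilon> \<longrightarrow>
      finite (S \<inter> {c..<d}) \<and> even (w d - w c + card (S \<inter> {c..<d}))" for s
  proof -
    obtain k l where l: "\<forall>\<^sub>F r in at_left s. r \<notin> S \<and> f r = k"
      and r: "\<forall>\<^sub>F r in at_right s. r \<notin> S \<and> f r = l" and odd: "odd (l - k) \<longleftrightarrow> s \<in> S"
      using jump by blast
    obtain b1 where b1: "b1 < s" "\<And>r. b1 < r \<Longrightarrow> r < s \<Longrightarrow> r \<notin> S \<and> f r = k"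
      using l by (auto simp: eventually_at_left_field)
    obtain b2 where b2: "b2 > s" "\<And>r. s < r \<Longrightarrow> r < b2 \<Longrightarrow> r \<notin> S \<and> f r = l"
      using r by (auto simp: eventually_at_right_field)
    have wl: "w c = k" if "b1 < c" "c \<le> s" for c
      using b1 that by (intro wI) (auto simp: eventually_at_left_field intro!: exI[of _ b1])
    have wr: "w d = l" if "s < d" "d < b2" for d
      using b2 that by (intro wI) (auto simp: eventually_at_left_field intro!: exI[of _ s])
    define \<epsilon> where "\<epsilon> = min (s - b1) (b2 - s)"
    have "finite (S \<inter> {c..<d}) \<and> even (w d - w c + card (S \<inter> {c..<d}))"
      if cd: "c \<le> s" "s \<le> d" "d - c < \<epsilon>" for c d
    proof (cases "d = s")
      case True
      have "r \<notin> S" if "c \<le> r" "r < s" for r using b1(2)[of r] that cd by (auto simp: \<epsilon>_def)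
      then have "S \<inter> {c..<d} = {}" using True by force
      moreover have "w d = w c" using True wl cd by (simp add: \<epsilon>_def)
      ultimately show ?thesis by simp
    next
      case False
      then have sd: "s < d" using cd by simp
      have "r = s" if "r \<in> S" "c \<le> r" "r < d" for r
        using b1(2)[of r] b2(2)[of r] that cd by (cases r s rule: linorder_cases) (auto simp: \<epsilon>_def)
      then have sub: "S \<inter> {c..<d} \<subseteq> {s}" by auto
      have mem: "s \<in> S \<inter> {c..<d} \<longleftrightarrow> s \<in> S" using cd sd by simp
      have w: "w c = k" "w d = l" using wl wr cd sd by (auto simp: \<epsilon>_def)
      from subset_singletonD[OF sub] show ?thesis
      proof
        assume I: "S \<inter> {c..<d} = {}"
        then have "even (l - k)" using mem odd by simp
        then show ?thesis unfolding I w by simp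
      next
        assume I: "S \<inter> {c..<d} = {s}"
        then have "odd (l - k)" using mem odd by simp
        then show ?thesis unfolding I w by simp
      qed
    qed
    moreover have "\<epsilon> > 0" using b1 b2 by (simp add: \<epsilon>_def)
    ultimately show ?thesis by blast
  qed
  have "finite (S \<inter> {0..<p}) \<and> even (w p - w 0 + card (S \<inter> {0..<p}))"
    using less_imp_le[OF p]
  proof (induction rule: Bolzano)
    case (trans a b c)
    have "S \<inter> {a..<c} = S \<inter> {a..<b} \<union> S \<inter> {b..<c}" using trans by auto
    moreover have "S \<inter> {a..<b} \<inter> (S \<inter> {b..<c}) = {}" by auto
    ultimately have "finite (S \<inter> {a..<c})" "card (S \<inter> {a..<c}) = card (S \<inter> {a..<b}) + card (S \<inter> {b..<c})"
      using trans by (auto simp: card_Un_disjoint)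
    moreover have "w c - w a + int (card (S \<inter> {a..<b}) + card (S \<inter> {b..<c})) =
        (w b - w a + int (card (S \<inter> {a..<b}))) + (w c - w b + int (card (S \<inter> {b..<c})))" by simp
    ultimately show ?case using trans(1,2) by (metis even_add)
  next
    case (local x)
    show ?case by (rule near)
  qed
  moreover have "w p = w 0"
  proof -
    obtain k where "\<forall>\<^sub>F r in at_left 0. r \<notin> S \<and> f r = k" using jump[of 0] by blast
    then obtain b where b: "b < 0" "\<And>r. b < r \<Longrightarrow> r < 0 \<Longrightarrow> f r = k"
      unfolding eventually_at_left_field by blast
    have "f r = k" if "b + p < r" "r < p" for r
      using b(2)[of "r - p"] that per[of "r - p"] by simp
    then have "w p = k" using b(1) by (intro wI) (auto simp: eventually_at_left_field intro!: exI[of _ "b + p"])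
    moreover have "w 0 = k" using b by (intro wI) (auto simp: eventually_at_left_field)
    ultimately show ?thesis by simp
  qed
  ultimately show ?thesis by simp
qed

lemma path_image_full_period:
  fixes \<beta> :: "real \<Rightarrow> complex"
  assumes per: "\<And>t. \<beta> (t + 2 * pi) = \<beta> t"
  shows "path_image (\<lambda>u. \<beta> (2 * pi * u)) = range \<beta>"
proof
  have "\<beta> t \<in> path_image (\<lambda>u. \<beta> (2 * pi * u))" if "t \<in> {0..<2 * pi}" for t
  proof -
    have "\<beta> t = \<beta> (2 * pi * (t / (2 * pi)))" "t / (2 * pi) \<in> {0..1}" using that by auto
    then show ?thesis unfolding path_image_def by blast
  qed
  then show "range \<beta> \<subseteq> path_image (\<lambda>u. \<beta> (2 * pi * u))"
    using periodic_range[of \<beta> 0, OF per] by auto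
qed (auto simp: path_image_def)

text \<open>The hypothesis \<open>once\<close> says that no crossing of the two curves is a self-crossing of \<open>\<beta>\<close>;
  otherwise the winding number could jump by an even number.\<close>

theorem even_crossings_of_closed_curves:
  fixes \<alpha> \<beta> \<alpha>' \<beta>' :: "real \<Rightarrow> complex"
  assumes \<alpha>: "\<And>s. (\<alpha> has_vector_derivative \<alpha>' s) (at s)" and per\<alpha>: "\<And>t. \<alpha> (t + 2 * pi) = \<alpha> t"
    and \<beta>: "\<And>t. (\<beta> has_vector_derivative \<beta>' t) (at t)" and per\<beta>: "\<And>t. \<beta> (t + 2 * pi) = \<beta> t"
    and transverse: "\<And>s t. \<alpha> s = \<beta> t \<Longrightarrow> Im (cnj (\<beta>' t) * \<alpha>' s) \<noteq> 0"
    and once: "\<And>s t r. \<alpha> s = \<beta> t \<Longrightarrow> t < r \<Longrightarrow> r < t + 2 * pi \<Longrightarrow> \<beta> r \<noteq> \<beta> t"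
  shows "even (card ({s. \<alpha> s \<in> range \<beta>} \<inter> {0..<2 * pi}))"
proof -
  define W where "W = winding_number (\<lambda>u. \<beta> (2 * pi * u))"
  define f where "f s = \<lfloor>Re (W (\<alpha> s))\<rfloor>" for s
  have cont: "continuous_on UNIV \<beta>"
    using \<beta> by (meson continuous_at_imp_continuous_on has_vector_derivative_continuous)
  have path: "path (\<lambda>u. \<beta> (2 * pi * u))" "pathfinish (\<lambda>u. \<beta> (2 * pi * u)) = pathstart (\<lambda>u. \<beta> (2 * pi * u))"
    using per\<beta>[of 0] unfolding path_def
    by (auto intro!: continuous_on_compose2[OF cont] continuous_intros simp: pathstart_def pathfinish_def)
  show ?thesis
  proof (rule even_card_jumps[where f=f])
    fix s
    show "\<exists>k l. (\<forall>\<^sub>F r in at_left s. r \<notin> {s. \<alpha> s \<in> range \<beta>} \<and> f r = k) \<and>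
        (\<forall>\<^sub>F r in at_right s. r \<notin> {s. \<alpha> s \<in> range \<beta>} \<and> f r = l) \<and>
        (odd (l - k) \<longleftrightarrow> s \<in> {s. \<alpha> s \<in> range \<beta>})"
    proof (cases "\<alpha> s \<in> range \<beta>")
      case True
      then obtain t where t: "\<alpha> s = \<beta> t" by auto
      show ?thesis
      proof (rule winding_number_jump[of \<beta> \<alpha> "\<alpha>' s" s "\<beta>' t" t])
        fix k l
        assume "\<forall>\<^sub>F r in at_left s. \<alpha> r \<notin> range \<beta> \<and> winding_number (\<lambda>u. \<beta> (2 * pi * u)) (\<alpha> r) = k"
          "\<forall>\<^sub>F r in at_right s. \<alpha> r \<notin> range \<beta> \<and> winding_number (\<lambda>u. \<beta> (2 * pi * u)) (\<alpha> r) = l"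
          and kl: "l = k + 1 \<or> l = k - 1"
        then have "\<forall>\<^sub>F r in at_left s. r \<notin> {s. \<alpha> s \<in> range \<beta>} \<and> f r = \<lfloor>Re k\<rfloor>"
          "\<forall>\<^sub>F r in at_right s. r \<notin> {s. \<alpha> s \<in> range \<beta>} \<and> f r = \<lfloor>Re l\<rfloor>"
          by (auto elim: eventually_mono simp: f_def W_def)
        moreover have "\<lfloor>Re l\<rfloor> = \<lfloor>Re k\<rfloor> + 1 \<or> \<lfloor>Re l\<rfloor> = \<lfloor>Re k\<rfloor> - 1" using kl by auto
        then have "odd (\<lfloor>Re l\<rfloor> - \<lfloor>Re k\<rfloor>)" by auto
        ultimately show ?thesis using True by blast
      qed (use cont per\<beta> \<alpha> \<beta> t once[OF t] transverse[OF t] in auto)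
    next
      case False
      then have "\<alpha> s \<notin> path_image (\<lambda>u. \<beta> (2 * pi * u))" using path_image_full_period[of \<beta>, OF per\<beta>] by simp
      then have "\<forall>\<^sub>F z in nhds (\<alpha> s). z \<notin> range \<beta> \<and> W z = W (\<alpha> s)"
        using winding_number_eventually_eq[OF path] path_image_full_period[of \<beta>, OF per\<beta>] W_def by simp
      moreover have "filterlim \<alpha> (nhds (\<alpha> s)) (at s within A)" for A
        using has_vector_derivative_continuous[OF \<alpha>]
        by (auto simp: continuous_within intro: tendsto_within_subset)
      ultimately have "\<forall>\<^sub>F r in at s within A. \<alpha> r \<notin> range \<beta> \<and> W (\<alpha> r) = W (\<alpha> s)" for A
        by (rule eventually_compose_filterlim)
      then have "\<forall>\<^sub>F r in at s within A. r \<notin> {s. \<alpha> s \<in> range \<beta>} \<and> f r = f s" for A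
        by (rule eventually_mono) (simp add: f_def)
      then show ?thesis using False by fastforce
    qed
  qed (use per\<alpha> in \<open>auto simp: f_def\<close>)
qed

section \<open>Crossings of two components of a diagram\<close>

definition component :: "vdiagram \<Rightarrow> nat \<Rightarrow> real \<Rightarrow> complex" where
  "component D i t = curve D (i, cis t)"

definition component_deriv :: "vdiagram \<Rightarrow> nat \<Rightarrow> real \<Rightarrow> complex" where
  "component_deriv D i t = tangent D (i, cis t)"

lemma sphere_eq_cis: "sphere 0 1 = cis ` {0..<2 * pi}"
proof -
  have "z \<in> range cis" if "norm z = 1" for z
    using that cis_Arg[of z] by (metis norm_zero rangeI sgn_eq scaleR_one div_by_1 of_real_1 zero_neq_one)
  then have "sphere 0 1 = range cis" by (auto simp: sphere_def)
  also have "\<dots> = cis ` {0..<2 * pi}"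
    using periodic_range[of cis 0] by (simp add: cis.code)
  finally show ?thesis .
qed

lemma cis_eq_imp_eq:
  assumes "cis s = cis t" "t < s + 2 * pi" "s < t + 2 * pi"
  shows "s = t"
proof -
  have "sin s = sin t" "cos s = cos t" using assms(1) by (auto simp: complex_eq_iff)
  then obtain n :: int where n: "s = t + 2 * pi * of_int n"
    using sin_cos_eq_iff[of s t] by (auto simp: mult_ac)
  then have "2 * pi * of_int n < 2 * pi * 1" "2 * pi * (-1) < 2 * pi * of_int n" using assms(2,3) by auto
  then have "real_of_int n < 1" "-1 < real_of_int n"
    using mult_less_cancel_left_pos[of "2 * pi" "real_of_int n" 1]
      mult_less_cancel_left_pos[of "2 * pi" "-1" "real_of_int n"] pi_gt_zero by argo+
  then show ?thesis using n by simp
qed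

lemma component_has_derivative:
  assumes "generic_immersion D" "i < circle_count D"
  shows "(component D i has_vector_derivative component_deriv D i s) (at s)"
proof -
  have "component D i C1_differentiable_on UNIV"
    using assms by (simp add: generic_immersion_def component_def[abs_def])
  then obtain d where d: "\<And>t. (component D i has_vector_derivative d t) (at t)"
    unfolding C1_differentiable_on_def by auto
  have "((\<lambda>t. s + t) has_vector_derivative 1) (at 0)"
    by (auto intro!: derivative_eq_intros simp: has_vector_derivative_def)
  from vector_diff_chain_at[OF this, of "component D i" "d s"] d[of s]
  have "((\<lambda>t. component D i (s + t)) has_vector_derivative d s) (at 0)"
    by (simp add: o_def)
  then have "component_deriv D i s = d s"
    unfolding component_deriv_def tangent_def
    by (simp add: component_def cis_mult vector_derivative_at)
  with d show ?thesis by simp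
qed

lemma component_periodic: "component D i (t + 2 * pi) = component D i t"
  by (simp add: component_def cis.code)

lemma double_pointsI:
  assumes "curve D (i, cis s) = curve D (j, cis t)" "(i, cis s) \<noteq> (j, cis t)"
    "i < circle_count D" "j < circle_count D"
  shows "((i, cis s), (j, cis t)) \<in> double_points D"
  using assms by (auto simp: double_points_def circles_def)

text \<open>A double point has only two preimages, so the double points of the two components correspond
  to the parameters at which component \<open>i\<close> meets component \<open>j\<close>.\<close>

lemma even_double_points:
  assumes D: "generic_immersion D" and ij: "i \<noteq> j" "i < circle_count D" "j < circle_count D"
  shows "even (card {(x, y) \<in> double_points D. fst x = i \<and> fst y = j})" (is "even (card ?P)")
proof -
  let ?S = "{s. component D i s \<in> range (component D j)} \<inter> {0..<2 * pi}"
  have unique: "y = z" if "(x, y) \<in> double_points D" "(x, z) \<in> double_points D" for x y z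
    using D that unfolding generic_immersion_def by blast
  have sym: "(y, x) \<in> double_points D" if "(x, y) \<in> double_points D" for x y
    using that by (auto simp: double_points_def)
  have "even (card ?S)"
  proof (rule even_crossings_of_closed_curves)
    fix s t assume st: "component D i s = component D j t"
    then have dp: "((i, cis s), (j, cis t)) \<in> double_points D"
      using ij by (intro double_pointsI) (auto simp: component_def)
    then have "\<not> collinear {0, component_deriv D j t, component_deriv D i s}"
      using D by (auto simp: generic_immersion_def component_deriv_def insert_commute)
    then have "Im (component_deriv D i s / component_deriv D j t) \<noteq> 0"
      by (simp add: collinear_iff_Reals complex_is_Real_iff)
    then show "Im (cnj (component_deriv D j t) * component_deriv D i s) \<noteq> 0"
      by (simp add: Im_complex_div_eq_0 mult.commute)
    fix r assume r: "t < r" "r < t + 2 * pi"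
    show "component D j r \<noteq> component D j t"
    proof
      assume "component D j r = component D j t"
      then have "((i, cis s), (j, cis r)) \<in> double_points D"
        using ij st by (intro double_pointsI) (auto simp: component_def)
      then have "cis r = cis t" using unique dp by blast
      then show False using cis_eq_imp_eq[of r t] r by auto
    qed
  qed (use D ij in \<open>auto intro: component_has_derivative component_periodic\<close>)
  also have "card ?S = card ((\<lambda>s. (i, cis s)) ` ?S)"
    by (rule card_image[symmetric]) (auto intro!: inj_onI cis_eq_imp_eq)
  also have "(\<lambda>s. (i, cis s)) ` ?S = fst ` ?P"
  proof (intro equalityI subsetI)
    fix x assume "x \<in> (\<lambda>s. (i, cis s)) ` ?S"
    then obtain s t where "x = (i, cis s)" "component D i s = component D j t" by auto
    then have "(x, (j, cis t)) \<in> ?P" using ij double_pointsI[of D i s j t] by (auto simp: component_def)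
    then show "x \<in> fst ` ?P" by force
  next
    fix x assume "x \<in> fst ` ?P"
    then obtain z w where x: "x = (i, z)" and dp: "((i, z), (j, w)) \<in> double_points D" by auto
    then have "z \<in> sphere 0 1" "w \<in> sphere 0 1" "curve D (i, z) = curve D (j, w)"
      by (auto simp: double_points_def circles_def)
    then obtain s t where "s \<in> {0..<2 * pi}" "z = cis s" "w = cis t"
      unfolding sphere_eq_cis by blast
    then show "x \<in> (\<lambda>s. (i, cis s)) ` ?S"
      using x \<open>curve D (i, z) = curve D (j, w)\<close> by (auto simp: component_def)
  qed
  also have "card (fst ` ?P) = card ?P"
    by (rule card_image) (auto intro!: inj_onI dest: unique)
  finally show ?thesis .
qed

section \<open>Oddly linked pairs of components\<close>

definition crossings_between ::
    "vdiagram \<Rightarrow> nat \<Rightarrow> nat \<Rightarrow> ((nat \<times> complex) \<times> (nat \<times> complex)) set" where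
  "crossings_between D i j = (over D \<union> (over D)\<inverse>) \<inter> {(x, y). fst x = i \<and> fst y = j}"

text \<open>Unordered pairs, so that distinct pairs need distinct virtual crossings.\<close>

definition odd_pairs :: "vdiagram \<Rightarrow> nat set set" where
  "odd_pairs D = {{i, j} | i j. i \<noteq> j \<and> odd (card (crossings_between D i j))}"

lemma over_subset_double_points:
  assumes "virtual_link_diagram D"
  shows "over D \<union> (over D)\<inverse> \<subseteq> double_points D"
  using assms by (auto simp: virtual_link_diagram_def double_points_def)

lemma double_points_subset: "double_points D \<subseteq> dom_circles D \<times> dom_circles D"
  by (auto simp: double_points_def)

lemma over_in_dom:
  assumes "virtual_link_diagram D" "(x, y) \<in> over D"
  shows "x \<in> dom_circles D \<and> y \<in> dom_circles D"
  using assms by (auto simp: virtual_link_diagram_def double_points_def)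

lemma finite_crossings_between:
  assumes "virtual_link_diagram D"
  shows "finite (crossings_between D i j)"
proof -
  have "finite (double_points D)"
    using assms by (simp add: virtual_link_diagram_def generic_immersion_def)
  then show ?thesis
    using over_subset_double_points[OF assms] by (auto simp: crossings_between_def intro: finite_subset)
qed

lemma odd_pairs_subset:
  assumes "virtual_link_diagram D"
  shows "odd_pairs D \<subseteq> Pow {..<circle_count D}"
proof
  fix e assume "e \<in> odd_pairs D"
  then obtain i j where e: "e = {i, j}" "odd (card (crossings_between D i j))"
    by (auto simp: odd_pairs_def)
  then have "crossings_between D i j \<noteq> {}" by auto
  then show "e \<in> Pow {..<circle_count D}"
    using over_subset_double_points[OF assms] double_points_subset[of D] e(1)
    by (fastforce simp: crossings_between_def circles_def)
qed

lemma finite_odd_pairs: "virtual_link_diagram D \<Longrightarrow> finite (odd_pairs D)"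
  by (meson finite_Pow_iff finite_lessThan finite_subset odd_pairs_subset)

lemma strand_component:
  assumes "proper_strand c r D A"
  obtains i where "\<And>x. x \<in> A \<Longrightarrow> fst x = i" "\<And>x. x \<in> A \<Longrightarrow> curve D x \<in> cball c r"
proof -
  obtain i a b where A: "A = arc_of_circle i a b"
    and t: "\<And>t. a < t \<Longrightarrow> t < b \<Longrightarrow> curve D (i, cis t) \<in> ball c r"
      "curve D (i, cis a) \<in> sphere c r" "curve D (i, cis b) \<in> sphere c r"
    using assms unfolding proper_strand_def by blast
  have "curve D (i, cis t) \<in> cball c r" if "t \<in> {a..b}" for t
    using that t(1)[of t] t(2,3) by (cases "t = a \<or> t = b") (auto simp: less_le)
  then show thesis unfolding A by (intro that[of i]) (auto simp: A arc_of_circle_def)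
qed

text \<open>No crossing involves both a point of the strands in the disk and a point outside.  So the
  crossings that differ between the two diagrams are just \<open>X\<close> and \<open>X'\<close>, and only their parities
  for each pair of components matter.\<close>

lemma odd_pairs_differ_in_disk:
  assumes D: "virtual_link_diagram D" and D': "virtual_link_diagram D'"
    and disk: "differ_in_disk c r S D D'"
    and X: "crossings_are D (\<Union>S) X" and X': "crossings_are D' (\<Union>S) X'"
    and parity: "\<And>i j. i \<noteq> j \<Longrightarrow>
      even (card ((X \<union> X\<inverse>) \<inter> {(x, y). fst x = i \<and> fst y = j})) \<longleftrightarrow>
      even (card ((X' \<union> X'\<inverse>) \<inter> {(x, y). fst x = i \<and> fst y = j}))"
  shows "odd_pairs D' = odd_pairs D"
proof -
  define U where "U = \<Union>S"
  note X = X[folded U_def] and X' = X'[folded U_def]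
  define Q where "Q E = over E \<union> (over E)\<inverse>" for E :: vdiagram
  have count: "circle_count D' = circle_count D"
    and strands: "\<And>A. A \<in> S \<Longrightarrow> proper_strand c r D A \<and> proper_strand c r D' A"
    and out: "\<And>x. x \<in> dom_circles D - U \<Longrightarrow> curve D' x = curve D x \<and> curve D x \<notin> cball c r"
    and over: "\<And>x y. x \<in> dom_circles D - U \<Longrightarrow> y \<in> dom_circles D - U \<Longrightarrow>
        (x, y) \<in> over D' \<longleftrightarrow> (x, y) \<in> over D"
    using disk unfolding differ_in_disk_def U_def by blast+
  have inU: "curve D x \<in> cball c r" "curve D' x \<in> cball c r" if "x \<in> U" for x
    using that strands strand_component unfolding U_def by (metis UnionE)+
  have split: "Q E = (Q E \<inter> U \<times> U) \<union> (Q E \<inter> (- U) \<times> (- U))" if "E \<in> {D, D'}" for E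
  proof -
    have same: "x \<in> U \<longleftrightarrow> y \<in> U" if "(x, y) \<in> Q E" for x y
    proof -
      have "(x, y) \<in> double_points E"
        using that \<open>E \<in> {D, D'}\<close> over_subset_double_points D D' by (auto simp: Q_def)
      then have "x \<in> dom_circles D" "y \<in> dom_circles D" "curve E x = curve E y"
        using \<open>E \<in> {D, D'}\<close> count by (auto simp: double_points_def)
      then show ?thesis using inU out \<open>E \<in> {D, D'}\<close> by (metis DiffI insertE singletonD)
    qed
    have "Q E \<subseteq> U \<times> U \<union> (- U) \<times> (- U)"
    proof (rule subrelI)
      fix x y assume "(x, y) \<in> Q E"
      from same[OF this] show "(x, y) \<in> U \<times> U \<union> (- U) \<times> (- U)"
        unfolding Un_iff mem_Sigma_iff Compl_iff by blast
    qed
    then show ?thesis by blast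
  qed
  have inner: "Q E \<inter> U \<times> U = Y \<union> Y\<inverse>"
    if "virtual_link_diagram E" "crossings_are E U Y" for E Y
  proof -
    have Y: "double_points E \<inter> U \<times> U = Y \<union> Y\<inverse>" and "Y \<subseteq> over E"
      using that(2) by (simp_all add: crossings_are_def)
    then have "Y \<union> Y\<inverse> \<subseteq> Q E" by (auto simp: Q_def)
    moreover have "Q E \<subseteq> double_points E"
      using over_subset_double_points[OF that(1)] by (simp only: Q_def)
    ultimately show ?thesis unfolding Y[symmetric] by (intro equalityI Int_mono Int_greatest) simp_all
  qed
  have outer: "Q D' \<inter> (- U) \<times> (- U) = Q D \<inter> (- U) \<times> (- U)"
  proof (rule set_eqI)
    fix p :: "(nat \<times> complex) \<times> (nat \<times> complex)"
    obtain x y where p: "p = (x, y)" by (cases p)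
    have dom: "u \<in> dom_circles D \<and> v \<in> dom_circles D" if "(u, v) \<in> over D \<union> over D'" for u v
      using that over_in_dom[OF D, of u v] over_in_dom[OF D', of u v] unfolding count by blast
    have same: "(u, v) \<in> over D' \<longleftrightarrow> (u, v) \<in> over D" if "u \<notin> U" "v \<notin> U" for u v
    proof (cases "u \<in> dom_circles D \<and> v \<in> dom_circles D")
      case True
      with that have "u \<in> dom_circles D - U" "v \<in> dom_circles D - U" by simp_all
      then show ?thesis by (rule over)
    next
      case False
      then show ?thesis using dom[of u v] by (meson UnI1 UnI2)
    qed
    show "p \<in> Q D' \<inter> (- U) \<times> (- U) \<longleftrightarrow> p \<in> Q D \<inter> (- U) \<times> (- U)"
      using same[of x y] same[of y x]
      unfolding p Q_def Int_iff Un_iff mem_Sigma_iff Compl_iff converse_iff by argo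
  qed
  have par: "even (card (crossings_between D i j)) \<longleftrightarrow> even (card (crossings_between D' i j))"
    if "i \<noteq> j" for i j
  proof -
    let ?F = "{(x, y). fst x = i \<and> fst y = (j::nat)} :: ((nat \<times> complex) \<times> (nat \<times> complex)) set"
    let ?O = "Q D \<inter> (- U) \<times> (- U) \<inter> ?F"
    have eq: "card (crossings_between E i j) = card ((Y \<union> Y\<inverse>) \<inter> ?F) + card ?O"
      if E: "E \<in> {D, D'}" and Y: "crossings_are E U Y" for E Y
    proof -
      have E': "virtual_link_diagram E" using E D D' by auto
      have Qo: "Q E \<inter> (- U) \<times> (- U) = Q D \<inter> (- U) \<times> (- U)" using E outer by auto
      have "Q E = (Y \<union> Y\<inverse>) \<union> (Q D \<inter> (- U) \<times> (- U))"
        using split[OF E] unfolding inner[OF E' Y] Qo .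
      then have un: "crossings_between E i j = ((Y \<union> Y\<inverse>) \<inter> ?F) \<union> ?O"
        unfolding crossings_between_def Q_def[symmetric] by blast
      have fin: "finite ((Y \<union> Y\<inverse>) \<inter> ?F)" "finite ?O"
        using finite_crossings_between[OF E', of i j] un by (metis finite_Un)+
      have "Y \<union> Y\<inverse> \<subseteq> U \<times> U" using inner[OF E' Y] by blast
      then have "((Y \<union> Y\<inverse>) \<inter> ?F) \<inter> ?O = {}" by blast
      then show ?thesis unfolding un using card_Un_disjoint[OF fin] by blast
    qed
    show ?thesis using eq[of D X] eq[of D' X'] X X' parity[OF that] by simp
  qed
  then have "i \<noteq> j \<and> odd (card (crossings_between D' i j)) \<longleftrightarrow>
      i \<noteq> j \<and> odd (card (crossings_between D i j))" for i j by blast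
  then show ?thesis unfolding odd_pairs_def by simp
qed

lemma odd_pairs_reidemeister1:
  assumes "virtual_link_diagram D" "virtual_link_diagram D'" "reidemeister1 D D'"
  shows "odd_pairs D' = odd_pairs D"
proof -
  obtain c r A x y where disk: "differ_in_disk c r {A} D D'"
    and X: "crossings_are D A {}" "crossings_are D' A {(x, y)}"
    using assms(3) unfolding reidemeister1_def by blast
  have "proper_strand c r D A" using disk by (simp add: differ_in_disk_def)
  then obtain k where "\<And>x. x \<in> A \<Longrightarrow> fst x = k" by (rule strand_component) blast
  moreover have "x \<in> A" "y \<in> A" using X(2) by (auto simp: crossings_are_def)
  ultimately have "fst x = fst y" by auto
  then have "({(x, y)} \<union> {(x, y)}\<inverse>) \<inter> {(x, y). fst x = i \<and> fst y = j} = {}" if "i \<noteq> j" for i j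
    using that by auto
  then show ?thesis
    using odd_pairs_differ_in_disk[OF assms(1,2) disk, of "{}" "{(x, y)}"] X by simp
qed

lemma odd_pairs_reidemeister2:
  assumes "virtual_link_diagram D" "virtual_link_diagram D'" "reidemeister2 D D'"
  shows "odd_pairs D' = odd_pairs D"
proof -
  obtain c r A B x x' y y' where disk: "differ_in_disk c r {A, B} D D'"
    and mem: "x \<in> A" "x' \<in> B" "y \<in> A" "y' \<in> B" and ne: "x \<noteq> y"
    and X: "crossings_are D (A \<union> B) {}" "crossings_are D' (A \<union> B) {(x, x'), (y, y')}"
    using assms(3) unfolding reidemeister2_def by blast
  have "proper_strand c r D A" "proper_strand c r D B" using disk by (simp_all add: differ_in_disk_def)
  then obtain k l where "\<And>x. x \<in> A \<Longrightarrow> fst x = k" "\<And>x. x \<in> B \<Longrightarrow> fst x = l"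
    by (metis strand_component)
  then have fst: "fst x = k" "fst y = k" "fst x' = l" "fst y' = l" using mem by auto
  have "even (card (({(x, x'), (y, y')} \<union> {(x, x'), (y, y')}\<inverse>) \<inter> {(x, y). fst x = i \<and> fst y = j}))"
    if "i \<noteq> j" for i j
  proof -
    consider "i = k" "j = l" | "i = l" "j = k" | "\<not> (i = k \<and> j = l)" "\<not> (i = l \<and> j = k)" by blast
    then show ?thesis
    proof cases
      case 1
      then have "({(x, x'), (y, y')} \<union> {(x, x'), (y, y')}\<inverse>) \<inter> {(x, y). fst x = i \<and> fst y = j} =
          {(x, x'), (y, y')}" using fst that by auto
      then show ?thesis using ne by simp
    next
      case 2
      then have "({(x, x'), (y, y')} \<union> {(x, x'), (y, y')}\<inverse>) \<inter> {(x, y). fst x = i \<and> fst y = j} =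
          {(x', x), (y', y)}" using fst that by auto
      then show ?thesis using ne by simp
    next
      case 3
      then have "({(x, x'), (y, y')} \<union> {(x, x'), (y, y')}\<inverse>) \<inter> {(x, y). fst x = i \<and> fst y = j} = {}"
        using fst by auto
      then show ?thesis by simp
    qed
  qed
  then show ?thesis
    using odd_pairs_differ_in_disk[OF assms(1,2) disk, of "{}" "{(x, x'), (y, y')}"] X by simp
qed

text \<open>The count depends only on the components of the three strands, hence is the same for the two
  triangles of a third Reidemeister move.\<close>

lemma card_layered_triangle:
  fixes F :: "((nat \<times> complex) \<times> (nat \<times> complex)) set"
  assumes "ab \<in> A" "ac \<in> A" "ba \<in> B" "bc \<in> B" "ca \<in> C" "cb \<in> C"
    and "A \<inter> B = {}" "A \<inter> C = {}" "B \<inter> C = {}"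
  defines "X \<equiv> {(ab, ba), (ac, ca), (bc, cb)}"
  shows "card ((X \<union> X\<inverse>) \<inter> F) =
    of_bool ((ab, ba) \<in> F) + of_bool ((ac, ca) \<in> F) + of_bool ((bc, cb) \<in> F) +
    of_bool ((ba, ab) \<in> F) + of_bool ((ca, ac) \<in> F) + of_bool ((cb, bc) \<in> F)"
proof -
  have ne: "a \<noteq> b" "b \<noteq> a" "a \<noteq> c" "c \<noteq> a" "b \<noteq> c" "c \<noteq> b" if "a \<in> {ab, ac}" "b \<in> {ba, bc}" "c \<in> {ca, cb}" for a b c
    using that assms by auto
  have Y: "X \<union> X\<inverse> = {(ab, ba), (ac, ca), (bc, cb), (ba, ab), (ca, ac), (cb, bc)}"
    by (auto simp: X_def)
  have "card ((X \<union> X\<inverse>) \<inter> F) = (\<Sum>p\<in>(X \<union> X\<inverse>) \<inter> F. 1)" by simp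
  also have "\<dots> = (\<Sum>p\<in>X \<union> X\<inverse>. if p \<in> F then 1 else 0)"
    by (rule sum.inter_restrict) (simp add: Y)
  also have "\<dots> = (\<Sum>p\<in>X \<union> X\<inverse>. of_bool (p \<in> F))" by (simp add: of_bool_def)
  also have "\<dots> = of_bool ((ab, ba) \<in> F) + (of_bool ((ac, ca) \<in> F) + (of_bool ((bc, cb) \<in> F) +
    (of_bool ((ba, ab) \<in> F) + (of_bool ((ca, ac) \<in> F) + of_bool ((cb, bc) \<in> F)))))"
    unfolding Y using ne[of ab ba ca] ne[of ab bc cb] ne[of ac ba cb] ne[of ac bc ca] by simp
  finally show ?thesis by simp
qed

lemma odd_pairs_reidemeister3:
  assumes "virtual_link_diagram D" "virtual_link_diagram D'" "reidemeister3 D D'"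
  shows "odd_pairs D' = odd_pairs D"
proof -
  obtain c r A B C where disj: "A \<inter> B = {}" "A \<inter> C = {}" "B \<inter> C = {}"
    and disk: "differ_in_disk c r {A, B, C} D D'"
    and tri: "layered_triangle D A B C" "layered_triangle D' A B C"
    using assms(3) unfolding reidemeister3_def by blast
  obtain ab ac ba bc ca cb where mem: "ab \<in> A" "ac \<in> A" "ba \<in> B" "bc \<in> B" "ca \<in> C" "cb \<in> C"
    and X: "crossings_are D (A \<union> B \<union> C) {(ab, ba), (ac, ca), (bc, cb)}"
    using tri(1) unfolding layered_triangle_def by blast
  obtain ab' ac' ba' bc' ca' cb' where mem': "ab' \<in> A" "ac' \<in> A" "ba' \<in> B" "bc' \<in> B" "ca' \<in> C" "cb' \<in> C"
    and X': "crossings_are D' (A \<union> B \<union> C) {(ab', ba'), (ac', ca'), (bc', cb')}"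
    using tri(2) unfolding layered_triangle_def by blast
  have "proper_strand c r D A" "proper_strand c r D B" "proper_strand c r D C"
    using disk by (simp_all add: differ_in_disk_def)
  then obtain k l m where "\<And>x. x \<in> A \<Longrightarrow> fst x = k" "\<And>x. x \<in> B \<Longrightarrow> fst x = l"
    "\<And>x. x \<in> C \<Longrightarrow> fst x = m" by (metis strand_component)
  then have "fst ab = k" "fst ac = k" "fst ba = l" "fst bc = l" "fst ca = m" "fst cb = m"
    "fst ab' = k" "fst ac' = k" "fst ba' = l" "fst bc' = l" "fst ca' = m" "fst cb' = m"
    using mem mem' by auto
  then have "card (({(ab, ba), (ac, ca), (bc, cb)} \<union> {(ab, ba), (ac, ca), (bc, cb)}\<inverse>) \<inter> {(x, y). fst x = i \<and> fst y = j}) =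
     card (({(ab', ba'), (ac', ca'), (bc', cb')} \<union> {(ab', ba'), (ac', ca'), (bc', cb')}\<inverse>) \<inter> {(x, y). fst x = i \<and> fst y = j})"
    for i j
    unfolding card_layered_triangle[OF mem disj] card_layered_triangle[OF mem' disj] by simp
  then show ?thesis
    using odd_pairs_differ_in_disk[OF assms(1,2) disk, of "{(ab, ba), (ac, ca), (bc, cb)}"
        "{(ab', ba'), (ac', ca'), (bc', cb')}"] X X' by (simp add: Un_assoc)
qed

lemma odd_pairs_detour_move:
  assumes "detour_move D D'"
  shows "odd_pairs D' = odd_pairs D"
  using assms by (simp add: detour_move_def odd_pairs_def crossings_between_def)

section \<open>Invariance and the lower bound\<close>

lemma connected_circle: "connected ({i} \<times> sphere (0::complex) 1)"
  by (intro connected_Times connected_sphere) auto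

text \<open>A circle is connected, so it is mapped into a single circle.\<close>

lemma homeomorphism_component:
  assumes f: "continuous_on (circles m) f" "f ` circles m \<subseteq> circles m'" and i: "(i, z) \<in> circles m"
  shows "fst (f (i, z)) = fst (f (i, 1))"
proof -
  let ?C = "{i} \<times> sphere (0::complex) 1"
  have C: "?C \<subseteq> circles m" "(i, z) \<in> ?C" "(i, 1) \<in> ?C" using i by (auto simp: circles_def)
  let ?k = "\<lambda>x. real (fst (f x))"
  have conn: "connected (?k ` ?C)"
    by (intro connected_continuous_image connected_circle continuous_intros continuous_on_subset[OF f(1) C(1)])
  have "f x \<in> circles m'" if "x \<in> ?C" for x using f(2) C(1) that by blast
  then have "?k ` ?C \<subseteq> real ` {..<m'}" by (fastforce simp: circles_def)
  then have "finite (?k ` ?C)" by (rule finite_subset) simp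
  then obtain k where k: "?k ` ?C = {k}"
    using connected_finite_iff_sing[OF conn] C by blast
  have "?k (i, z) = k" "?k (i, 1) = k" using k C(2,3) by blast+
  then show ?thesis by simp
qed

text \<open>A homeomorphism of the circles permutes the components.  If it respects classical crossings, it
  carries oddly linked pairs to oddly linked pairs.\<close>

lemma card_odd_pairs_le:
  assumes D: "virtual_link_diagram D" and D': "virtual_link_diagram D'"
    and h: "homeomorphism (dom_circles D) (dom_circles D') f g"
    and over: "\<forall>x\<in>dom_circles D. \<forall>y\<in>dom_circles D. (f x, f y) \<in> over D' \<longleftrightarrow> (x, y) \<in> over D"
  shows "card (odd_pairs D) \<le> card (odd_pairs D')"
proof -
  define \<sigma> where "\<sigma> i = fst (f (i, 1))" for i
  define \<tau> where "\<tau> i = fst (g (i, 1))" for i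
  have one: "(i, 1) \<in> dom_circles D" if "i < circle_count D" for i
    using that by (simp add: circles_def)
  have \<sigma>: "fst (f x) = \<sigma> (fst x)" if "x \<in> dom_circles D" for x
    using that homeomorphism_component[of "circle_count D" f "circle_count D'" "fst x" "snd x"] h
    by (auto simp: \<sigma>_def homeomorphism_def)
  have \<tau>: "fst (g x) = \<tau> (fst x)" if "x \<in> dom_circles D'" for x
    using that homeomorphism_component[of "circle_count D'" g "circle_count D" "fst x" "snd x"] h
    by (auto simp: \<tau>_def homeomorphism_def)
  have fg: "g (f x) = x" "f x \<in> dom_circles D'" if "x \<in> dom_circles D" for x
    using that h by (auto simp: homeomorphism_def)
  have gf: "f (g y) = y" "g y \<in> dom_circles D" if "y \<in> dom_circles D'" for y
    using that h by (auto simp: homeomorphism_def)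
  have inv: "\<tau> (\<sigma> i) = i" if "i < circle_count D" for i
    using \<tau>[of "f (i, 1)"] \<sigma>[OF one[OF that]] fg[OF one[OF that]] by simp
  have crossings: "crossings_between D' (\<sigma> i) (\<sigma> j) = map_prod f f ` crossings_between D i j"
    if ij: "i < circle_count D" "j < circle_count D" for i j
  proof (intro equalityI subsetI)
    fix p assume p: "p \<in> crossings_between D' (\<sigma> i) (\<sigma> j)"
    obtain u v where uv: "p = (u, v)" by (cases p)
    then have o: "(u, v) \<in> over D' \<or> (v, u) \<in> over D'" using p by (auto simp: crossings_between_def)
    then have dom: "u \<in> dom_circles D'" "v \<in> dom_circles D'" using over_in_dom[OF D'] by blast+
    then have "(g u, g v) \<in> over D \<or> (g v, g u) \<in> over D"
      using o over gf by metis
    moreover have "fst (g u) = i" "fst (g v) = j"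
      using p uv \<tau>[OF dom(1)] \<tau>[OF dom(2)] inv ij by (auto simp: crossings_between_def)
    ultimately have "(g u, g v) \<in> crossings_between D i j" by (auto simp: crossings_between_def)
    moreover have "p = map_prod f f (g u, g v)" using uv gf dom by simp
    ultimately show "p \<in> map_prod f f ` crossings_between D i j" by blast
  next
    fix p assume "p \<in> map_prod f f ` crossings_between D i j"
    then obtain x y where xy: "p = (f x, f y)" "(x, y) \<in> over D \<union> (over D)\<inverse>" "fst x = i" "fst y = j"
      by (auto simp: crossings_between_def)
    then have dom: "x \<in> dom_circles D" "y \<in> dom_circles D"
      using over_subset_double_points[OF D] double_points_subset[of D] by auto
    then show "p \<in> crossings_between D' (\<sigma> i) (\<sigma> j)"
      using xy over \<sigma> by (auto simp: crossings_between_def)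
  qed
  have card: "card (crossings_between D' (\<sigma> i) (\<sigma> j)) = card (crossings_between D i j)"
    if "i < circle_count D" "j < circle_count D" for i j
    unfolding crossings[OF that]
  proof (rule card_image, rule inj_onI)
    have dom: "crossings_between D i j \<subseteq> dom_circles D \<times> dom_circles D"
      using over_subset_double_points[OF D] double_points_subset[of D]
      by (auto simp: crossings_between_def)
    fix p q assume "p \<in> crossings_between D i j" "q \<in> crossings_between D i j" "map_prod f f p = map_prod f f q"
    then show "p = q" using dom fg by (cases p; cases q) (metis map_prod_simp mem_Sigma_iff prod.inject subsetD)
  qed
  have "(\<lambda>e. \<sigma> ` e) ` odd_pairs D \<subseteq> odd_pairs D'"
  proof (rule image_subsetI)
    fix e assume e: "e \<in> odd_pairs D"
    then obtain i j where ij: "e = {i, j}" "i \<noteq> j" "odd (card (crossings_between D i j))"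
      by (auto simp: odd_pairs_def)
    then have lt: "i < circle_count D" "j < circle_count D" using odd_pairs_subset[OF D] e by auto
    then have "\<sigma> i \<noteq> \<sigma> j" using inv ij(2) by metis
    moreover have "odd (card (crossings_between D' (\<sigma> i) (\<sigma> j)))" using card[OF lt] ij(3) by simp
    ultimately show "\<sigma> ` e \<in> odd_pairs D'" using ij(1) by (auto simp: odd_pairs_def)
  qed
  moreover have "inj_on (\<lambda>e. \<sigma> ` e) (odd_pairs D)"
  proof (rule inj_on_inverseI[where g="\<lambda>e. \<tau> ` e"])
    fix e assume "e \<in> odd_pairs D"
    then have "e \<subseteq> {..<circle_count D}" using odd_pairs_subset[OF D] by auto
    then show "\<tau> ` (\<sigma> ` e) = e" using inv by force
  qed
  ultimately show ?thesis using finite_odd_pairs[OF D'] by (meson card_inj_on_le)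
qed

lemma card_odd_pairs_planar_isotopic:
  assumes D: "virtual_link_diagram D" "virtual_link_diagram D'" and iso: "planar_isotopic D D'"
  shows "card (odd_pairs D') = card (odd_pairs D)"
proof (rule antisym)
  obtain f g where h: "homeomorphism (dom_circles D) (dom_circles D') f g"
    and over: "\<forall>x\<in>dom_circles D. \<forall>y\<in>dom_circles D. (f x, f y) \<in> over D' \<longleftrightarrow> (x, y) \<in> over D"
    using iso unfolding planar_isotopic_def by blast
  show "card (odd_pairs D) \<le> card (odd_pairs D')"
    using card_odd_pairs_le[OF D h over] .
  have "\<forall>x\<in>dom_circles D'. \<forall>y\<in>dom_circles D'. (g x, g y) \<in> over D \<longleftrightarrow> (x, y) \<in> over D'"
    using over h unfolding homeomorphism_def by (metis imageI)
  then show "card (odd_pairs D') \<le> card (odd_pairs D)"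
    using card_odd_pairs_le[OF D(2,1) homeomorphism_symD[OF h]] by blast
qed

lemma card_odd_pairs_elementary_move:
  assumes "(D, D') \<in> elementary_move"
  shows "card (odd_pairs D') = card (odd_pairs D)"
proof -
  have D: "virtual_link_diagram D" "virtual_link_diagram D'"
    using assms by (auto simp: elementary_move_def)
  from assms consider "planar_isotopic D D'" | "reidemeister1 D D'" | "reidemeister2 D D'"
    | "reidemeister3 D D'" | "detour_move D D'" by (auto simp: elementary_move_def)
  then show ?thesis
    using card_odd_pairs_planar_isotopic[OF D] odd_pairs_reidemeister1[OF D]
      odd_pairs_reidemeister2[OF D] odd_pairs_reidemeister3[OF D] odd_pairs_detour_move
    by cases auto
qed

theorem card_odd_pairs_invariant:
  assumes "(D, D') \<in> virtual_isotopy" "virtual_link_diagram D"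
  shows "virtual_link_diagram D' \<and> card (odd_pairs D') = card (odd_pairs D)"
  using assms unfolding virtual_isotopy_def
proof (induction rule: rtrancl_induct)
  case base
  then show ?case by blast
next
  case (step E E')
  then show ?case
    using card_odd_pairs_elementary_move[of E E'] card_odd_pairs_elementary_move[of E' E]
    by (auto simp: elementary_move_def)
qed

text \<open>An even number of double points of which an odd number are classical leaves a virtual one.
  A virtual crossing determines the pair of components through it.\<close>

theorem card_odd_pairs_le_virtual_crossings:
  assumes D: "virtual_link_diagram D"
  shows "card (odd_pairs D) \<le> card (virtual_crossings D)"
proof -
  have gen: "generic_immersion D" and fin: "finite (double_points D)"
    using D by (auto simp: virtual_link_diagram_def generic_immersion_def)
  have unique: "y = z" if "(x, y) \<in> double_points D" "(x, z) \<in> double_points D" for x y z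
    using gen that unfolding generic_immersion_def by blast
  define witness where "witness e p \<longleftrightarrow> (\<exists>x y. (x, y) \<in> double_points D \<and> (x, y) \<notin> over D \<and> (y, x) \<notin> over D \<and>
      e = {fst x, fst y} \<and> p = curve D x)" for e p
  have "\<exists>p. witness e p" if e: "e \<in> odd_pairs D" for e
  proof -
    obtain i j where ij: "e = {i, j}" "i \<noteq> j" "odd (card (crossings_between D i j))"
      using e by (auto simp: odd_pairs_def)
    then have lt: "i < circle_count D" "j < circle_count D" using odd_pairs_subset[OF D] e by auto
    let ?P = "{(x, y) \<in> double_points D. fst x = i \<and> fst y = j}"
    have "crossings_between D i j \<subseteq> ?P"
      using over_subset_double_points[OF D] by (auto simp: crossings_between_def)
    moreover have "crossings_between D i j \<noteq> ?P"
      using ij(3) even_double_points[OF gen ij(2) lt] by auto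
    ultimately obtain x y where "(x, y) \<in> ?P" "(x, y) \<notin> crossings_between D i j" by auto
    then have "(x, y) \<in> double_points D" "(x, y) \<notin> over D" "(y, x) \<notin> over D" "e = {fst x, fst y}"
      using ij(1) by (auto simp: crossings_between_def)
    then show ?thesis unfolding witness_def by blast
  qed
  then obtain h where h: "\<And>e. e \<in> odd_pairs D \<Longrightarrow> witness e (h e)" by metis
  have det: "e = e'" if ee: "witness e p" "witness e' p" for e e' p
  proof -
    obtain x y where x: "(x, y) \<in> double_points D" "e = {fst x, fst y}" "p = curve D x"
      using ee(1) unfolding witness_def by blast
    obtain x' y' where x': "(x', y') \<in> double_points D" "e' = {fst x', fst y'}" "p = curve D x'"
      using ee(2) unfolding witness_def by blast
    show ?thesis
    proof (cases "x' = x")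
      case True
      then show ?thesis using unique x x' by metis
    next
      case False
      then have "(x, x') \<in> double_points D" "(x', x) \<in> double_points D"
        using x x' by (auto simp: double_points_def)
      then have "x' = y" "x = y'" using unique x(1) x'(1) by blast+
      then show ?thesis using x(2) x'(2) by auto
    qed
  qed
  have "inj_on h (odd_pairs D)" using det h by (metis inj_onI)
  moreover have "h ` odd_pairs D \<subseteq> virtual_crossings D"
    using h unfolding witness_def virtual_crossings_def by fast
  moreover have "virtual_crossings D \<subseteq> (\<lambda>p. curve D (fst p)) ` double_points D"
    unfolding virtual_crossings_def by force
  then have "finite (virtual_crossings D)" using fin finite_surj by blast
  ultimately show ?thesis by (meson card_inj_on_le)
qed

section \<open>One circle crossing concentric circles\<close>

text \<open>Points of the lower unit semicircle, with the distinct real parts \<open>1/(k+1)\<close>.  The bound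
  \<open>Im \<le> -1/2\<close> that holds from \<open>k = 1\<close> on places them where the torus is mapped to the plane by
  \<open>(u, v) \<mapsto> v (2 + u)\<close>, which sends meridians to concentric circles.\<close>

definition crossing_point :: "nat \<Rightarrow> complex" where
  "crossing_point k = Complex (1 / (real k + 1)) (- sqrt (1 - (1 / (real k + 1))\<^sup>2))"

text \<open>The unit circle around \<open>2\<close> passes through \<open>2 + u\<close> and \<open>2 + cnj u\<close> for \<open>u = crossing_point k\<close>;
  these are its two common points with the \<open>k\<close>-th concentric circle, the classical and the virtual
  crossing.\<close>

definition meridian_diagram :: "nat \<Rightarrow> vdiagram" where
  "meridian_diagram n =
     \<lparr>circle_count = Suc n,
      curve = (\<lambda>(i, z). if i = 0 then 2 + z else z * (2 + crossing_point i)),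
      over = (\<lambda>k. ((0, crossing_point k), (k, 1))) ` {1..n}\<rparr>"

lemma Re_crossing_point: "Re (crossing_point k) = 1 / (real k + 1)"
  by (simp add: crossing_point_def)

lemma Im_crossing_point: "k \<ge> 1 \<Longrightarrow> Im (crossing_point k) \<le> - 1 / 2"
proof -
  assume "k \<ge> 1"
  then have "1 / (real k + 1) \<le> 1 / 2" by (simp add: field_simps)
  then have "(1 / (real k + 1))\<^sup>2 \<le> (1 / 2)\<^sup>2" by (intro power_mono) auto
  moreover have "(1 / 2 :: real)\<^sup>2 = 1 / 4" by (simp add: power2_eq_square)
  ultimately have "(1 / 2)\<^sup>2 \<le> 1 - (1 / (real k + 1))\<^sup>2" by linarith
  then have "1 / 2 \<le> sqrt (1 - (1 / (real k + 1))\<^sup>2)" by (rule real_le_rsqrt)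
  then show ?thesis by (simp add: crossing_point_def)
qed

lemma norm_crossing_point: "norm (crossing_point k) = 1"
proof -
  have "1 / (real k + 1) \<le> 1" by simp
  then have "(1 / (real k + 1))\<^sup>2 \<le> 1" by (intro power_le_one) auto
  then show ?thesis by (simp add: crossing_point_def complex_norm)
qed

lemma inj_crossing_point: "crossing_point j = crossing_point k \<longleftrightarrow> j = k"
proof
  assume "crossing_point j = crossing_point k"
  then have "Re (crossing_point j) = Re (crossing_point k)" by simp
  then show "j = k" unfolding Re_crossing_point by (simp add: field_simps)
qed simp

lemma norm_two_plus:
  assumes "norm z = 1"
  shows "(norm (2 + z))\<^sup>2 = 5 + 4 * Re z"
proof -
  have "(Re z)\<^sup>2 + (Im z)\<^sup>2 = 1" using assms by (metis cmod_power2 one_power2)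
  then show ?thesis unfolding cmod_power2 by (simp add: power2_eq_square algebra_simps)
qed

lemma two_plus_nonzero: "norm z = 1 \<Longrightarrow> 2 + z \<noteq> (0 :: complex)"
proof
  assume "norm z = 1" "2 + z = 0"
  then have "z = -2" by (simp add: eq_neg_iff_add_eq_0 add.commute)
  then show False using \<open>norm z = 1\<close> by simp
qed

lemma circle_crossing:
  assumes "norm z = 1" "norm w = 1" "2 + z = w * (2 + crossing_point k)"
  shows "z = crossing_point k \<or> z = cnj (crossing_point k)"
proof -
  have "norm (2 + z) = norm (2 + crossing_point k)" using assms by (simp add: norm_mult)
  then have "5 + 4 * Re z = 5 + 4 * Re (crossing_point k)"
    using norm_two_plus[OF assms(1)] norm_two_plus[OF norm_crossing_point] by metis
  then have re: "Re z = Re (crossing_point k)" by simp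
  have "(Re z)\<^sup>2 + (Im z)\<^sup>2 = 1" "(Re (crossing_point k))\<^sup>2 + (Im (crossing_point k))\<^sup>2 = 1"
    using assms(1) norm_crossing_point[of k] by (metis cmod_power2 one_power2)+
  then have "(Im z)\<^sup>2 = (Im (crossing_point k))\<^sup>2" using re by simp
  then have "Im z = Im (crossing_point k) \<or> Im z = - Im (crossing_point k)" by (simp add: power2_eq_iff)
  then show ?thesis using re by (auto simp: complex_eq_iff)
qed

lemma concentric_circles:
  assumes "norm z = 1" "norm w = 1" "z * (2 + crossing_point j) = w * (2 + crossing_point k)"
  shows "j = k \<and> z = w"
proof -
  have "norm (2 + crossing_point j) = norm (2 + crossing_point k)"
    using assms by (metis mult_1 norm_mult)
  then have "5 + 4 * Re (crossing_point j) = 5 + 4 * Re (crossing_point k)"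
    using norm_two_plus[OF norm_crossing_point] by metis
  then have "j = k" unfolding Re_crossing_point by (simp add: field_simps)
  then show ?thesis using assms(3) two_plus_nonzero[OF norm_crossing_point] by simp
qed

lemma meridian_double_points:
  assumes "((i, z), (j, w)) \<in> double_points (meridian_diagram n)"
  shows "norm z = 1 \<and> norm w = 1 \<and> (i = 0 \<and> j \<in> {1..n} \<and> 2 + z = w * (2 + crossing_point j) \<or>
         j = 0 \<and> i \<in> {1..n} \<and> 2 + w = z * (2 + crossing_point i))"
proof -
  have *: "i \<le> n" "j \<le> n" "norm z = 1" "norm w = 1" "(i, z) \<noteq> (j, w)"
    "curve (meridian_diagram n) (i, z) = curve (meridian_diagram n) (j, w)"
    using assms by (auto simp: double_points_def circles_def meridian_diagram_def)
  consider "i = 0" "j = 0" | "i = 0" "j \<noteq> 0" | "i \<noteq> 0" "j = 0" | "i \<noteq> 0" "j \<noteq> 0" by blast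
  then show ?thesis
  proof cases
    case 4
    then have "z * (2 + crossing_point i) = w * (2 + crossing_point j)"
      using *(6) by (simp add: meridian_diagram_def)
    from concentric_circles[OF *(3,4) this] show ?thesis using *(5) by simp
  qed (use * in \<open>auto simp: meridian_diagram_def\<close>)
qed

lemma meridian_double_pointsI:
  assumes "norm z = 1" "norm w = 1" "k \<in> {1..n}" "2 + z = w * (2 + crossing_point k)"
  shows "((0, z), (k, w)) \<in> double_points (meridian_diagram n)"
  using assms by (auto simp: double_points_def circles_def meridian_diagram_def)

lemma meridian_partner:
  assumes "2 + z = w * (2 + crossing_point k)"
  shows "w = (2 + z) / (2 + crossing_point k)"
  using assms two_plus_nonzero[OF norm_crossing_point[of k]] by (simp add: field_simps)

lemma meridian_crossing_label:
  assumes "norm z = 1" "norm w = 1" "norm v = 1"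
    "2 + z = w * (2 + crossing_point j)" "2 + z = v * (2 + crossing_point k)"
  shows "j = k \<and> w = v"
  using concentric_circles[OF assms(2,3)] assms(4,5) by metis

lemma meridian_finite: "finite (double_points (meridian_diagram n))"
proof -
  let ?P = "(\<lambda>(k, z). ((0, z), (k, (2 + z) / (2 + crossing_point k)))) `
      (SIGMA k:{1..n}. {crossing_point k, cnj (crossing_point k)})"
  have "finite ?P" by simp
  have "double_points (meridian_diagram n) \<subseteq> ?P \<union> ?P\<inverse>"
  proof (rule subrelI)
    fix x y assume xy: "(x, y) \<in> double_points (meridian_diagram n)"
    obtain i z j w where x: "x = (i, z)" "y = (j, w)" by (metis prod.exhaust)
    have in_P: "((0, a), (k, b)) \<in> ?P"
      if "norm a = 1" "norm b = 1" "k \<in> {1..n}" "2 + a = b * (2 + crossing_point k)" for a b k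
    proof (rule image_eqI)
      show "((0, a), (k, b)) = (case (k, a) of (k, z) \<Rightarrow> ((0, z), (k, (2 + z) / (2 + crossing_point k))))"
        using meridian_partner[OF that(4)] by simp
      show "(k, a) \<in> (SIGMA k:{1..n}. {crossing_point k, cnj (crossing_point k)})"
        using circle_crossing[OF that(1,2,4)] that(3) by blast
    qed
    have norms: "norm z = 1" "norm w = 1" using meridian_double_points xy x by blast+
    from meridian_double_points[of i z j w n] xy x
    consider "i = 0" "j \<in> {1..n}" "2 + z = w * (2 + crossing_point j)"
      | "j = 0" "i \<in> {1..n}" "2 + w = z * (2 + crossing_point i)" by blast
    then show "(x, y) \<in> ?P \<union> ?P\<inverse>"
    proof cases
      case 1
      show ?thesis unfolding x 1(1) using in_P[OF norms 1(2,3)] by (rule UnI1)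
    next
      case 2
      show ?thesis unfolding x 2(1) using in_P[OF norms(2,1) 2(2,3)] by (intro UnI2 converseI)
    qed
  qed
  moreover have "finite (?P \<union> ?P\<inverse>)" using \<open>finite ?P\<close> by (intro finite_UnI) (simp only: finite_converse)+
  ultimately show ?thesis by (rule finite_subset)
qed

text \<open>All circles are round, which gives their tangents uniformly.\<close>

definition centre :: "nat \<Rightarrow> complex" where "centre i = (if i = 0 then 2 else 0)"
definition radius :: "nat \<Rightarrow> complex" where "radius i = (if i = 0 then 1 else 2 + crossing_point i)"

lemma meridian_curve: "curve (meridian_diagram n) (i, z) = centre i + z * radius i"
  by (simp add: meridian_diagram_def centre_def radius_def)

lemma radius_nonzero: "radius i \<noteq> 0"
  using two_plus_nonzero[OF norm_crossing_point[of i]] by (simp add: radius_def)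

lemma round_curve_derivative:
  "((\<lambda>t. a + z * cis t * c) has_vector_derivative z * (\<i> * cis t) * c) (at t)"
proof -
  have "((\<lambda>t. a + z * cis t * c) has_derivative (\<lambda>h. z * (h *\<^sub>R (\<i> * cis t)) * c)) (at t)"
    by (auto intro!: derivative_eq_intros)
  then show ?thesis by (simp add: has_vector_derivative_def)
qed

lemma meridian_tangent: "tangent (meridian_diagram n) (i, z) = \<i> * z * radius i"
proof -
  have "((\<lambda>t. centre i + z * cis t * radius i) has_vector_derivative z * (\<i> * cis 0) * radius i) (at 0)"
    by (rule round_curve_derivative)
  then show ?thesis unfolding tangent_def by (simp add: meridian_curve vector_derivative_at mult_ac)
qed

lemma meridian_transverse:
  assumes "norm z = 1" "norm w = 1" "k \<ge> 1" "2 + z = w * (2 + crossing_point k)"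
  shows "\<not> collinear {0, tangent (meridian_diagram n) (0, z), tangent (meridian_diagram n) (k, w)}"
proof -
  have z: "z \<noteq> 0" "z * cnj z = 1" using assms(1) complex_norm_square[of z] by auto
  have Im: "Im z \<noteq> 0"
    using circle_crossing[OF assms(1,2,4)] Im_crossing_point[OF assms(3)] by auto
  have "tangent (meridian_diagram n) (k, w) / tangent (meridian_diagram n) (0, z) = (2 + z) / z"
    using assms(3,4) by (simp add: meridian_tangent radius_def)
  also have "\<dots> = 2 * cnj z + 1" using z by (simp add: field_simps)
  finally have "Im (tangent (meridian_diagram n) (k, w) / tangent (meridian_diagram n) (0, z)) \<noteq> 0"
    using Im by simp
  then show ?thesis by (simp add: collinear_iff_Reals complex_is_Real_iff)
qed

lemma meridian_generic: "generic_immersion (meridian_diagram n)"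
  unfolding generic_immersion_def
proof (intro conjI allI impI ballI)
  let ?D = "meridian_diagram n"
  fix i
  have "((\<lambda>t. curve ?D (i, cis t)) has_vector_derivative 1 * (\<i> * cis t) * radius i) (at t)" for t
    using round_curve_derivative[of "centre i" 1 "radius i" t] by (simp add: meridian_curve)
  moreover have "continuous_on UNIV (\<lambda>t. 1 * (\<i> * cis t) * radius i)"
    by (intro continuous_intros)
  ultimately show "(\<lambda>t. curve ?D (i, cis t)) C1_differentiable_on UNIV"
    unfolding C1_differentiable_on_def by (intro exI[of _ "\<lambda>t. 1 * (\<i> * cis t) * radius i"]) blast
next
  fix x assume "x \<in> dom_circles (meridian_diagram n)"
  then show "tangent (meridian_diagram n) x \<noteq> 0"
    by (cases x) (auto simp: meridian_tangent radius_nonzero circles_def)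
next
  show "finite (double_points (meridian_diagram n))" by (rule meridian_finite)
next
  let ?D = "meridian_diagram n"
  fix p assume p: "p \<in> double_points ?D"
  obtain i z j w where x: "p = ((i, z), (j, w))" by (metis prod.exhaust)
  then have norms: "norm z = 1" "norm w = 1" using meridian_double_points p by blast+
  from meridian_double_points[of i z j w n] p x
  consider "i = 0" "j \<ge> 1" "2 + z = w * (2 + crossing_point j)"
    | "j = 0" "i \<ge> 1" "2 + w = z * (2 + crossing_point i)" by auto
  then have "\<not> collinear {0, tangent ?D (i, z), tangent ?D (j, w)}"
  proof cases
    case 1
    then show ?thesis using meridian_transverse[OF norms 1(2,3), of n] by simp
  next
    case 2
    then show ?thesis using meridian_transverse[OF norms(2,1) 2(2,3), of n] by (simp add: insert_commute)
  qed
  then show "case p of (x, y) \<Rightarrow> \<not> collinear {0, tangent ?D x, tangent ?D y}" using x by simp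
next
  let ?D = "meridian_diagram n"
  fix x y z assume xy: "(x, y) \<in> double_points ?D \<and> (x, z) \<in> double_points ?D"
  obtain i a j b k c where eq: "x = (i, a)" "y = (j, b)" "z = (k, c)" by (metis prod.exhaust)
  have 1: "norm a = 1 \<and> norm b = 1 \<and> (i = 0 \<and> j \<in> {1..n} \<and> 2 + a = b * (2 + crossing_point j) \<or>
         j = 0 \<and> i \<in> {1..n} \<and> 2 + b = a * (2 + crossing_point i))"
    using meridian_double_points[of i a j b n] xy eq by blast
  have 2: "norm a = 1 \<and> norm c = 1 \<and> (i = 0 \<and> k \<in> {1..n} \<and> 2 + a = c * (2 + crossing_point k) \<or>
         k = 0 \<and> i \<in> {1..n} \<and> 2 + c = a * (2 + crossing_point i))"
    using meridian_double_points[of i a k c n] xy eq by blast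
  show "y = z"
  proof (cases "i = 0")
    case True
    then show ?thesis using 1 2 eq meridian_crossing_label[of a b c j k] by auto
  next
    case False
    then have "2 + b = 2 + c" "j = 0" "k = 0" using 1 2 by auto
    then show ?thesis using eq by simp
  qed
qed

lemma meridian_over_double:
  assumes "k \<in> {1..n}"
  shows "((0, crossing_point k), (k, 1)) \<in> double_points (meridian_diagram n)"
  using assms by (intro meridian_double_pointsI) (auto simp: norm_crossing_point)

lemma meridian_virtual_link_diagram: "virtual_link_diagram (meridian_diagram n)"
proof -
  have "over (meridian_diagram n) \<subseteq> double_points (meridian_diagram n)"
    using meridian_over_double by (auto simp: meridian_diagram_def)
  moreover have "asym (over (meridian_diagram n))"
    by (auto simp: meridian_diagram_def intro!: asymI)
  ultimately show ?thesis by (simp add: virtual_link_diagram_def meridian_generic)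
qed

lemma card_virtual_crossings_meridian: "card (virtual_crossings (meridian_diagram n)) \<le> n"
proof -
  have "virtual_crossings (meridian_diagram n) \<subseteq> (\<lambda>k. 2 + cnj (crossing_point k)) ` {1..n}"
  proof
    fix p assume "p \<in> virtual_crossings (meridian_diagram n)"
    then obtain i z j w where p: "p = curve (meridian_diagram n) (i, z)"
      and dp: "((i, z), (j, w)) \<in> double_points (meridian_diagram n)"
      and virt: "((i, z), (j, w)) \<notin> over (meridian_diagram n)" "((j, w), (i, z)) \<notin> over (meridian_diagram n)"
      unfolding virtual_crossings_def by (smt (verit) mem_Collect_eq prod.exhaust)
    have p': "p = curve (meridian_diagram n) (j, w)" using dp p by (auto simp: double_points_def)
    have virtual: "2 + a = 2 + cnj (crossing_point k)"
      if "norm a = 1" "norm b = 1" "k \<in> {1..n}" "2 + a = b * (2 + crossing_point k)"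
        "((0, a), (k, b)) \<notin> over (meridian_diagram n)" for a b k
    proof -
      have "a \<noteq> crossing_point k"
      proof
        assume a: "a = crossing_point k"
        then have "b = 1" using that(4) two_plus_nonzero[OF norm_crossing_point[of k]] by simp
        then show False using that(3,5) a by (auto simp: meridian_diagram_def)
      qed
      then show ?thesis using circle_crossing[OF that(1,2,4)] by simp
    qed
    have norms: "norm z = 1" "norm w = 1" using meridian_double_points dp by blast+
    from meridian_double_points[OF dp] consider
      "i = 0" "j \<in> {1..n}" "2 + z = w * (2 + crossing_point j)"
      | "j = 0" "i \<in> {1..n}" "2 + w = z * (2 + crossing_point i)" by blast
    then show "p \<in> (\<lambda>k. 2 + cnj (crossing_point k)) ` {1..n}"
    proof cases
      case 1
      then have "p = 2 + cnj (crossing_point j)"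
        using virtual[OF norms] virt p by (simp add: meridian_diagram_def)
      then show ?thesis using 1(2) by blast
    next
      case 2
      then have "p = 2 + cnj (crossing_point i)"
        using virtual[OF norms(2,1)] virt p' by (simp add: meridian_diagram_def)
      then show ?thesis using 2(2) by blast
    qed
  qed
  then have "card (virtual_crossings (meridian_diagram n)) \<le> card ((\<lambda>k. 2 + cnj (crossing_point k)) ` {1..n})"
    by (intro card_mono) auto
  also have "\<dots> \<le> n" using card_image_le[of "{1..n}"] by simp
  finally show ?thesis .
qed

section \<open>Immersing a part of the torus\<close>

text \<open>The map must send the longitude to \<open>u \<mapsto> 2 + u\<close> and the chosen meridians to concentric circles.
  The map \<open>v (2 + u)\<close> does so, but on the longitude, at \<open>v = 1\<close>, its Jacobian determinant
  \<open>-2 Im u\<close> is positive only where the circle around \<open>2\<close> runs away from the origin.  A term with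
  a simple zero at \<open>v = 1\<close> leaves the longitude in place and shears its neighbourhood to its left,
  which adds the coefficient \<open>twist u\<close> to the determinant.  That coefficient vanishes for
  \<open>Im u \<le> -1/2\<close>, so the meridians through these \<open>u\<close> remain round circles; elsewhere it is at
  least large enough to outweigh \<open>2 Im u\<close>.  The square makes it continuously differentiable.\<close>

definition twist :: "complex \<Rightarrow> real" where
  "twist z = (max 0 (1 + 2 * Im z))\<^sup>2"

definition torus_map :: "complex \<times> complex \<Rightarrow> complex" where
  "torus_map = (\<lambda>(u, v). v * (2 + u * of_real (1 - Im v * twist u)))"

definition torus_map_du :: "complex \<times> complex \<Rightarrow> complex" where
  "torus_map_du = (\<lambda>(u, v). v * u * (\<i> * of_real (1 - Im v * twist u) -
     of_real (Im v * (4 * max 0 (1 + 2 * Im u) * Re u))))"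

definition torus_map_dv :: "complex \<times> complex \<Rightarrow> complex" where
  "torus_map_dv = (\<lambda>(u, v). v * (\<i> * (2 + u * of_real (1 - Im v * twist u)) - u * of_real (Re v * twist u)))"

lemma has_real_derivative_square_pos_part:
  "((\<lambda>y. (max 0 y)\<^sup>2) has_real_derivative 2 * max 0 y) (at (y::real))"
proof (cases y "0 :: real" rule: linorder_cases)
  case less
  have "((\<lambda>y. 0) has_real_derivative 0) (at y)" by simp
  then have "((\<lambda>y. (max 0 y)\<^sup>2) has_real_derivative 0) (at y)"
    by (rule has_field_derivative_transform_within_open[of _ _ _ "{..<0}"]) (use less in auto)
  then show ?thesis using less by simp
next
  case greater
  have "((\<lambda>y. y\<^sup>2) has_real_derivative 2 * y) (at y)" by (auto intro!: derivative_eq_intros)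
  then have "((\<lambda>y. (max 0 y)\<^sup>2) has_real_derivative 2 * y) (at y)"
    by (rule has_field_derivative_transform_within_open[of _ _ _ "{0<..}"]) (use greater in auto)
  then show ?thesis using greater by simp
next
  case equal
  have "(\<lambda>h. (max 0 h)\<^sup>2 / h) \<midarrow>0\<rightarrow> (0::real)"
  proof (rule Lim_null_comparison)
    have "norm ((max 0 h)\<^sup>2 / h) \<le> \<bar>h\<bar>" for h :: real
      by (cases "h > 0") (auto simp: max_def power2_eq_square)
    then show "\<forall>\<^sub>F h in at 0. norm ((max 0 h)\<^sup>2 / h) \<le> \<bar>h::real\<bar>" by simp
    show "(\<lambda>h. \<bar>h\<bar>) \<midarrow>0\<rightarrow> (0::real)" by (rule tendsto_rabs_zero) (rule tendsto_ident_at)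
  qed
  then show ?thesis using equal by (simp add: DERIV_def)
qed

lemma torus_map_derivative:
  "((\<lambda>w. torus_map (torus_cover w)) has_derivative
    (\<lambda>h. of_real (fst h) * torus_map_du (torus_cover w) + of_real (snd h) * torus_map_dv (torus_cover w))) (at w)"
proof -
  have "((\<lambda>t. (max 0 (1 + 2 * sin t))\<^sup>2) has_real_derivative
      2 * max 0 (1 + 2 * sin t) * (2 * cos t)) (at t)" for t :: real
    by (rule DERIV_chain2[OF has_real_derivative_square_pos_part]) (auto intro!: derivative_eq_intros)
  moreover have "(*) (2 * max 0 (1 + 2 * sin t) * (2 * cos t)) =
      (\<lambda>h. h * (4 * max 0 (1 + 2 * sin t) * cos t))" for t :: real
    by (simp add: fun_eq_iff)
  ultimately have "((\<lambda>t. twist (cis t)) has_derivative (\<lambda>h. h * (4 * max 0 (1 + 2 * sin t) * cos t))) (at t)" for t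
    unfolding has_field_derivative_def by (simp add: twist_def)
  from has_derivative_compose[OF has_derivative_fst[OF has_derivative_ident] this]
  have twist: "((\<lambda>w. twist (cis (fst w))) has_derivative
      (\<lambda>h. fst h * (4 * max 0 (1 + 2 * sin (fst w)) * cos (fst w)))) (at w)" for w :: "real \<times> real"
    by this
  have "((\<lambda>w. cis (snd w) * (2 + cis (fst w) * of_real (1 - sin (snd w) * twist (cis (fst w))))) has_derivative
    (\<lambda>h. of_real (fst h) * torus_map_du (torus_cover w) + of_real (snd h) * torus_map_dv (torus_cover w))) (at w)"
    apply (rule derivative_eq_intros twist refl)+
    apply (rule ext)
    apply (simp add: torus_map_du_def torus_map_dv_def torus_cover_def scaleR_conv_of_real algebra_simps)
    done
  then show ?thesis by (simp add: torus_map_def torus_cover_def)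
qed

definition torus_jacobian :: "complex \<times> complex \<Rightarrow> real" where
  "torus_jacobian p = Im (cnj (torus_map_du p) * torus_map_dv p)"

lemma continuous_twist [continuous_intros]:
  "continuous_on A f \<Longrightarrow> continuous_on A (\<lambda>x. twist (f x))"
  unfolding twist_def by (intro continuous_intros)

lemma continuous_torus_partials: "continuous_on A torus_map_du" "continuous_on A torus_map_dv"
  unfolding torus_map_du_def torus_map_dv_def case_prod_beta by (intro continuous_intros)+

definition immersed_part :: "(complex \<times> complex) set" where
  "immersed_part = {p \<in> torus. torus_jacobian p > 0}"

lemma oriented_immersion_torus_map: "oriented_immersion immersed_part torus_map"
  unfolding oriented_immersion_def
proof (intro conjI exI[of _ "\<lambda>w h. of_real (fst h) * torus_map_du (torus_cover w) +
      of_real (snd h) * torus_map_dv (torus_cover w)"] allI impI)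
  have "continuous_on UNIV torus_jacobian"
    unfolding torus_jacobian_def by (intro continuous_intros continuous_torus_partials)
  then have "open {p. 0 < torus_jacobian p}"
    by (intro open_Collect_less continuous_on_const)
  then show "openin (top_of_set torus) immersed_part"
    unfolding immersed_part_def Collect_conj_eq by (simp add: openin_open_Int)
  fix w
  show "((\<lambda>v. torus_map (torus_cover v)) has_derivative
     (\<lambda>h. of_real (fst h) * torus_map_du (torus_cover w) + of_real (snd h) * torus_map_dv (torus_cover w))) (at w)"
    by (rule torus_map_derivative)
next
  fix v :: "real \<times> real"
  have cover: "continuous_on A torus_cover" for A
    unfolding torus_cover_def by (intro continuous_intros)
  show "continuous_on {w. torus_cover w \<in> immersed_part} (\<lambda>w. of_real (fst v) * torus_map_du (torus_cover w) +
      of_real (snd v) * torus_map_dv (torus_cover w))"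
    by (intro continuous_intros continuous_on_compose2[OF continuous_torus_partials(1) cover]
        continuous_on_compose2[OF continuous_torus_partials(2) cover]) auto
next
  fix w assume "torus_cover w \<in> immersed_part"
  then show "0 < Im (cnj (of_real (fst (1, 0)) * torus_map_du (torus_cover w) + of_real (snd (1, 0)) * torus_map_dv (torus_cover w)) *
     (of_real (fst (0, 1)) * torus_map_du (torus_cover w) + of_real (snd (0, 1)) * torus_map_dv (torus_cover w)))"
    by (simp add: immersed_part_def torus_jacobian_def)
qed

text \<open>With \<open>y = Im u\<close> the determinant is \<open>-2y + (1 + 2y)\<^sup>2 = (2y + 1/2)\<^sup>2 + 3/4\<close> wherever the
  twist is nonzero.\<close>

lemma longitude_immersed: "norm u = 1 \<Longrightarrow> (u, 1) \<in> immersed_part"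
proof -
  assume u: "norm u = 1"
  have uu: "cnj u * u = 1" using complex_norm_square[of u] u by (simp add: mult.commute)
  have "cnj (torus_map_du (u, 1)) * torus_map_dv (u, 1) =
      2 * cnj u + (cnj u * u) * (1 + \<i> * of_real (twist u))"
    by (simp add: torus_map_du_def torus_map_dv_def algebra_simps)
  then have "torus_jacobian (u, 1) = - 2 * Im u + twist u"
    unfolding torus_jacobian_def uu by simp
  moreover have "- 2 * Im u + twist u > 0"
  proof (cases "1 + 2 * Im u \<le> 0")
    case False
    then have "- 2 * Im u + twist u = (2 * Im u + 1 / 2)\<^sup>2 + 3 / 4"
      by (simp add: twist_def max_def power2_eq_square algebra_simps)
    then show ?thesis by (metis add_nonneg_pos zero_le_power2 zero_less_divide_iff zero_less_numeral)
  qed (simp add: twist_def)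
  ultimately show ?thesis using u by (simp add: immersed_part_def torus_def)
qed

lemma meridian_immersed:
  assumes "norm u = 1" "norm v = 1" "Im u \<le> - 1 / 2"
  shows "(u, v) \<in> immersed_part"
proof -
  have 0: "max 0 (1 + 2 * Im u) = 0" "twist u = 0" using assms(3) by (simp_all add: twist_def)
  have uu: "cnj u * u = 1" "cnj v * v = 1"
    using complex_norm_square[of u] complex_norm_square[of v] assms by (simp_all add: mult.commute)
  have "torus_map_du (u, v) = \<i> * v * u" "torus_map_dv (u, v) = \<i> * v * (2 + u)"
    unfolding torus_map_du_def torus_map_dv_def by (simp_all add: 0)
  then have "cnj (torus_map_du (u, v)) * torus_map_dv (u, v) = (cnj v * v) * (2 * cnj u + cnj u * u)"
    by (simp add: algebra_simps)
  then have "torus_jacobian (u, v) = - 2 * Im u"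
    unfolding torus_jacobian_def uu by simp
  then show ?thesis using assms by (simp add: immersed_part_def torus_def)
qed

definition torus_link :: "nat \<times> complex \<Rightarrow> (complex \<times> complex) \<times> real" where
  "torus_link = (\<lambda>(i, z). if i = 0 then ((z, 1), 1) else ((crossing_point i, z), 0))"

lemma embedding_torus_link:
  "embedding_map (top_of_set (circles m)) (top_of_set (torus \<times> UNIV)) torus_link"
proof (rule injective_closed_imp_embedding_map)
  \<comment> \<open>Continuity in the discrete first coordinate is automatic, so the case distinction is
    written as an arithmetic expression in it.\<close>
  let ?f = "\<lambda>x. ((of_bool (fst x = 0) * snd x + of_bool (fst x \<noteq> 0) * crossing_point (fst x),
      of_bool (fst x = 0) + of_bool (fst x \<noteq> 0) * snd x), of_bool (fst x = 0) :: real)"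
  have disc: "continuous_on A (\<lambda>x. g (fst x))" for A :: "(nat \<times> complex) set" and g :: "nat \<Rightarrow> 'a::topological_space"
    by (rule continuous_on_compose2[OF Topological_Spaces.continuous_on_discrete[of UNIV g]]) (auto intro: continuous_intros)
  have "continuous_on (circles m) ?f"
    by (intro continuous_intros disc)
  moreover have "torus_link = ?f" by (auto simp: torus_link_def fun_eq_iff)
  ultimately have cont: "continuous_on (circles m) torus_link" by (simp only:)
  have "torus_link ` circles m \<subseteq> torus \<times> UNIV"
    by (auto simp: torus_link_def circles_def torus_def norm_crossing_point split: if_splits)
  with cont show map: "continuous_map (top_of_set (circles m)) (top_of_set (torus \<times> UNIV)) torus_link"
    by (simp add: continuous_map_subtopology_eu flip: image_subset_iff_funcset)
  have "compact (circles m)"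
    using compact_Times[OF finite_imp_compact[of "{..<m}"] compact_sphere[of "0::complex" 1]]
    by (simp add: circles_def)
  then show "closed_map (top_of_set (circles m)) (top_of_set (torus \<times> UNIV)) torus_link"
    by (intro T1_Spaces.continuous_imp_closed_map map) (auto simp: compact_space_subtopology Hausdorff_space_subtopology)
  show "inj_on torus_link (topspace (top_of_set (circles m)))"
    by (auto simp: torus_link_def inj_on_def inj_crossing_point split: if_splits)
qed

text \<open>The projections of the longitude and of the \<open>k\<close>-th meridian meet only at
  \<open>(crossing_point k, 1)\<close>, so this is where the diagram has its classical crossings.\<close>

lemma represented_meridian_diagram: "represented_by torus_link (meridian_diagram n)"
  unfolding represented_by_def
proof (intro conjI exI[of _ immersed_part] exI[of _ torus_map] ballI)
  show "embedding_map (top_of_set (dom_circles (meridian_diagram n))) (top_of_set (torus \<times> UNIV)) torus_link"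
    by (rule embedding_torus_link)
  show "oriented_immersion immersed_part torus_map" by (rule oriented_immersion_torus_map)
next
  fix x assume x: "x \<in> dom_circles (meridian_diagram n)"
  then show "fst (torus_link x) \<in> immersed_part"
    using longitude_immersed meridian_immersed[OF norm_crossing_point _ Im_crossing_point]
    by (auto simp: torus_link_def circles_def)
  show "curve (meridian_diagram n) x = torus_map (fst (torus_link x))"
  proof (cases "fst x = 0")
    case False
    then have "twist (crossing_point (fst x)) = 0"
      using Im_crossing_point[of "fst x"] by (simp add: twist_def)
    then show ?thesis using False
      by (cases x) (simp add: torus_link_def torus_map_def meridian_diagram_def)
  qed (cases x, simp add: torus_link_def torus_map_def meridian_diagram_def)
next
  show "over (meridian_diagram n) = {(x, y). x \<in> dom_circles (meridian_diagram n) \<and>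
      y \<in> dom_circles (meridian_diagram n) \<and> fst (torus_link x) = fst (torus_link y) \<and>
      snd (torus_link y) < snd (torus_link x)}" (is "_ = ?R")
  proof (intro equalityI subrelI)
    fix x y assume "(x, y) \<in> over (meridian_diagram n)"
    then show "(x, y) \<in> ?R"
      by (auto simp: meridian_diagram_def circles_def torus_link_def norm_crossing_point)
  next
    fix x y assume "(x, y) \<in> ?R"
    moreover obtain i z j w where "x = (i, z)" "y = (j, w)" by (metis prod.exhaust)
    ultimately have "x = (0, crossing_point j)" "y = (j, 1)" "j \<in> {1..n}"
      by (auto simp: torus_link_def meridian_diagram_def circles_def split: if_splits)
    then show "(x, y) \<in> over (meridian_diagram n)" by (auto simp: meridian_diagram_def)
  qed
qed

section \<open>The links and their virtual crossing number\<close>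

lemma odd_pairs_meridian: "n \<le> card (odd_pairs (meridian_diagram n))"
proof -
  have "{0, k} \<in> odd_pairs (meridian_diagram n)" if k: "k \<in> {1..n}" for k
  proof -
    have "crossings_between (meridian_diagram n) 0 k = {((0, crossing_point k), (k, 1))}"
      using k by (auto simp: crossings_between_def meridian_diagram_def)
    then have "odd (card (crossings_between (meridian_diagram n) 0 k))" by simp
    then show ?thesis using k unfolding odd_pairs_def by force
  qed
  then have "(\<lambda>k. {0, k}) ` {1..n} \<subseteq> odd_pairs (meridian_diagram n)" by blast
  moreover have "inj_on (\<lambda>k. {0, k}) {1..n}" by (auto simp: inj_on_def doubleton_eq_iff)
  ultimately show ?thesis
    using card_inj_on_le[of "\<lambda>k. {0, k}" "{1..n}"] finite_odd_pairs[OF meridian_virtual_link_diagram] by simp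
qed

definition meridian_link :: "nat \<Rightarrow> vdiagram set" where
  "meridian_link n = virtual_isotopy `` {meridian_diagram n}"

lemma meridian_diagram_in_link: "meridian_diagram n \<in> meridian_link n"
  by (simp add: meridian_link_def virtual_isotopy_def)

lemma virtual_crossing_number_meridian_link: "virtual_crossing_number (meridian_link n) = n"
  unfolding virtual_crossing_number_def
proof (rule Least_equality)
  have lower: "n \<le> card (virtual_crossings D)" if "D \<in> meridian_link n" for D
  proof -
    have "(meridian_diagram n, D) \<in> virtual_isotopy" using that by (simp add: meridian_link_def)
    from card_odd_pairs_invariant[OF this meridian_virtual_link_diagram]
    have "n \<le> card (odd_pairs D)" "virtual_link_diagram D" using odd_pairs_meridian[of n] by auto
    then show ?thesis using card_odd_pairs_le_virtual_crossings by (meson order_trans)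
  qed
  then show "\<exists>D\<in>meridian_link n. card (virtual_crossings D) = n"
    using meridian_diagram_in_link card_virtual_crossings_meridian by (meson order_antisym)
  show "n \<le> k" if "\<exists>D\<in>meridian_link n. card (virtual_crossings D) = k" for k
    using that lower by blast
qed

theorem mainTheorem8:
  shows "\<exists>L :: nat \<Rightarrow> vdiagram set.
    inj_on L {1..} \<and>
    (\<forall>n\<ge>1. L n \<in> virtual_links \<and>
            virtual_crossing_number (L n) = n \<and>
            representable_in_thickened_torus (L n))"
proof (intro exI[of _ meridian_link] conjI allI impI)
  show "inj_on meridian_link {1..}"
    by (rule inj_on_inverseI[of _ virtual_crossing_number]) (rule virtual_crossing_number_meridian_link)
  fix n
  show "meridian_link n \<in> virtual_links"
    using meridian_virtual_link_diagram unfolding virtual_links_def meridian_link_def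
    by (intro quotientI) simp
  show "virtual_crossing_number (meridian_link n) = n"
    by (rule virtual_crossing_number_meridian_link)
  show "representable_in_thickened_torus (meridian_link n)"
    unfolding representable_in_thickened_torus_def
    using meridian_diagram_in_link meridian_virtual_link_diagram represented_meridian_diagram by blast
qed

end
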